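(* Let $P_1\subset[0,1]^2$ be the open parallelogram with vertices $(1/3,2/3),(1/2,1),(2/3,1/3),(1/2,0)$. Then $P_1$ is a dimension trap for the baker's map, i.e. $\dim_{\mathrm H}\mathcal J(P_1)=0$.
   Context: Let $X=[0,1]^2$. The baker's map is $B(x,y)=(2x,\frac y2)$ if $0\le x<\frac12$ and $B(x,y)=(2x-1,\frac{y+1}2)$ if $\frac12\le x<1$. For a bi-infinite sequence $u=(x_n)_{n\in\mathbb Z}\in\{0,1\}^{\mathbb Z}$, written $\dots x_{-1}x_0\cdot x_1x_2\dots$, put $\pi(u)=\left(\sum_{n\ge1}x_n2^{-n},\ \sum_{n\ge0}x_{-n}2^{-n-1}\right)$. The map $\pi$ conjugates the left shift $\sigma$ and $B$; points and sequences are used interchangeably, so the $B$-orbit of the point $\pi(u)$ is $(\pi(\sigma^n u))_{n\in\mathbb Z}$. For $H\subset X$ the survivor set is $\mathcal J(H)=\{(x,y)\in X: B^n(x,y)\notin H \text{ for all } n\in\mathbb Z\}$, i.e. $\mathcal J(H)=\{\pi(u): \pi(\sigma^nu)\notin H\ \text{for all } n\in\mathbb Z\}$. An open set $H$ is a dimension trap if $\dim_{\mathrm H}\mathcal J(H)=0$ (Hausdorff dimension). *)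

theory Defs
  imports "HOL-Analysis.Analysis"
begin

section \<open>Hausdorff dimension\<close>

text \<open>
  The \<open>s\<close>-th power of the diameter, with the usual conventions for the degenerate cases: the
  empty set contributes nothing, and every nonempty set contributes \<open>1\<close> when \<open>s = 0\<close>
  (so that the zero-dimensional measure counts points, whereas \<open>0 powr 0 = 0\<close>).
\<close>

definition diam_power :: "real \<Rightarrow> 'a::metric_space set \<Rightarrow> ennreal" where
  "diam_power s U = (if U = {} then 0 else if s = 0 then 1 else ennreal (diameter U powr s))"

text \<open>
  Boundedness is required separately because \<open>diameter\<close> is only meaningful on bounded sets.
  Coverings indexed by the naturals include the finite ones, by padding with empty sets.
\<close>

definition hausdorff_content :: "real \<Rightarrow> real \<Rightarrow> 'a::metric_space set \<Rightarrow> ennreal" where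
  "hausdorff_content s \<delta> A =
     (INF U \<in> {U :: nat \<Rightarrow> 'a set. A \<subseteq> (\<Union>i. U i) \<and> (\<forall>i. bounded (U i) \<and> diameter (U i) \<le> \<delta>)}.
        (\<Sum>i. diam_power s (U i)))"

definition hausdorff_measure :: "real \<Rightarrow> 'a::metric_space set \<Rightarrow> ennreal" where
  "hausdorff_measure s A = (SUP \<delta> \<in> {0<..}. hausdorff_content s \<delta> A)"

definition hausdorff_dim :: "'a::metric_space set \<Rightarrow> ereal" where
  "hausdorff_dim A = (INF s \<in> {s. 0 \<le> s \<and> hausdorff_measure s A = 0}. ereal s)"


section \<open>The baker's map and its symbolic coding\<close>

definition unit_square :: "(real \<times> real) set" where
  "unit_square = {0..1} \<times> {0..1}"

definition baker :: "real \<times> real \<Rightarrow> real \<times> real" where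
  "baker = (\<lambda>(x, y). if x < 1/2 then (2 * x, y / 2) else (2 * x - 1, (y + 1) / 2))"

definition binary_seqs :: "(int \<Rightarrow> nat) set" where
  "binary_seqs = UNIV \<rightarrow> {0, 1}"

definition shift :: "int \<Rightarrow> (int \<Rightarrow> nat) \<Rightarrow> (int \<Rightarrow> nat)" where
  "shift n u = (\<lambda>k. u (k + n))"

text \<open>The summation index of the first coordinate is lowered by one, to start at \<open>0\<close>.\<close>

definition coding :: "(int \<Rightarrow> nat) \<Rightarrow> real \<times> real" where
  "coding u = ((\<Sum>n. real (u (int n + 1)) / 2 ^ (n + 1)), (\<Sum>n. real (u (- int n)) / 2 ^ (n + 1)))"

text \<open>
  The orbit of a point is that of a sequence coding it.  A point with a dyadic coordinate may have
  several codings, and it survives as soon as one of them does.  These orbits are related to the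
  map \<open>baker\<close> by \<open>baker_coding\<close> and \<open>baker_orbit_in_survivor_set\<close> below.
\<close>

definition survivor_set :: "(real \<times> real) set \<Rightarrow> (real \<times> real) set" where
  "survivor_set H = {coding u | u. u \<in> binary_seqs \<and> (\<forall>n. coding (shift n u) \<notin> H)}"

definition dimension_trap :: "(real \<times> real) set \<Rightarrow> bool" where
  "dimension_trap H \<longleftrightarrow> openin (top_of_set unit_square) H \<and> hausdorff_dim (survivor_set H) = 0"

definition P1 :: "(real \<times> real) set" where
  "P1 = interior (convex hull {(1/3, 2/3), (1/2, 1), (2/3, 1/3), (1/2, 0)})"


section \<open>The coding conjugates the shift and the baker's map\<close>

lemma shift_eq_iterate: "shift (int n) = (shift 1 ^^ n)"
  by (induction n) (auto simp: shift_def fun_eq_iff algebra_simps)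

lemma shift_add: "shift m (shift n u) = shift (m + n) u"
  by (simp add: shift_def algebra_simps)

lemma shift_0: "shift 0 u = u"
  by (simp add: shift_def)

lemma summable_binary:
  fixes d :: "nat \<Rightarrow> nat"
  assumes "\<And>n. d n \<le> 1"
  shows "summable (\<lambda>n. real (d n) / 2 ^ (n + 1))"
proof (rule summable_comparison_test)
  show "\<exists>N. \<forall>n\<ge>N. norm (real (d n) / 2 ^ (n + 1)) \<le> (1/2) ^ n"
  proof (intro exI allI impI)
    fix n
    have "real (d n) \<le> 1" using assms[of n] by simp
    then show "norm (real (d n) / 2 ^ (n + 1)) \<le> (1/2) ^ n"
      by (simp add: field_simps)
  qed
  show "summable (\<lambda>n. (1/2 :: real) ^ n)" by (simp add: summable_geometric)
qed

lemma suminf_binary_Suc: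
  fixes d :: "nat \<Rightarrow> nat"
  assumes "\<And>n. d n \<le> 1"
  shows "(\<Sum>n. real (d n) / 2 ^ (n + 1)) = (real (d 0) + (\<Sum>n. real (d (Suc n)) / 2 ^ (n + 1))) / 2"
proof -
  have "(\<Sum>n. real (d (Suc n)) / 2 ^ (n + 1)) / 2 = (\<Sum>n. real (d (Suc n)) / 2 ^ (n + 1) / 2)"
    by (rule suminf_divide[OF summable_binary[of "\<lambda>n. d (Suc n)", OF assms], symmetric])
  also have "\<dots> = (\<Sum>n. real (d (Suc n)) / 2 ^ (Suc n + 1))"
    by (intro suminf_cong) simp
  also have "\<dots> = (\<Sum>n. real (d n) / 2 ^ (n + 1)) - real (d 0) / 2"
    using suminf_split_head[OF summable_binary[of d, OF assms]] by simp
  finally show ?thesis by (simp only: add_divide_distrib)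
qed

lemma suminf_binary_less_1:
  fixes d :: "nat \<Rightarrow> nat"
  assumes d: "\<And>n. d n \<le> 1" and k: "d k = 0"
  shows "(\<Sum>n. real (d n) / 2 ^ (n + 1)) < 1"
proof -
  have s: "(\<lambda>n. 1 / 2 ^ (n + 1) :: real) sums 1"
    using power_half_series by (simp add: power_divide)
  have sd: "summable (\<lambda>n. real (d n) / 2 ^ (n + 1))" by (rule summable_binary[OF d])
  have "0 < (\<Sum>n. 1 / 2 ^ (n + 1) - real (d n) / 2 ^ (n + 1) :: real)"
  proof (rule suminf_pos2[where i = k])
    show "summable (\<lambda>n. 1 / 2 ^ (n + 1) - real (d n) / 2 ^ (n + 1) :: real)"
      by (intro summable_diff sums_summable[OF s] sd)
    show "0 \<le> 1 / 2 ^ (n + 1) - real (d n) / 2 ^ (n + 1)" for n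
      using d[of n] by (simp add: divide_right_mono)
  qed (simp add: k)
  then show ?thesis
    using suminf_diff[OF sums_summable[OF s] sd] sums_unique[OF s] by simp
qed

text \<open>
  The hypothesis \<open>tail\<close> excludes the case \<open>x\<^sub>1x\<^sub>2x\<^sub>3\<dots> = 0111\<dots>\<close>: there the first coordinate is \<open>1/2\<close>,
  to which \<open>baker\<close> applies its right branch, whereas the shift follows the left one.
\<close>

lemma baker_coding:
  assumes u: "u \<in> binary_seqs" and tail: "u 1 = 1 \<or> (\<exists>n\<ge>2. u n = 0)"
  shows "baker (coding u) = coding (shift 1 u)"
proof -
  have u01: "u n = 0 \<or> u n = 1" and u1: "u n \<le> 1" for n
    using u unfolding binary_seqs_def by (auto simp: Pi_iff le_Suc_eq)
  define t where "t = (\<Sum>n. real (u (int n + 2)) / 2 ^ (n + 1))"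
  define y where "y = (\<Sum>n. real (u (- int n)) / 2 ^ (n + 1))"
  have x: "fst (coding u) = (real (u 1) + t) / 2"
    using suminf_binary_Suc[of "\<lambda>n. u (int n + 1)", OF u1]
    by (simp add: coding_def t_def add.commute)
  have sx: "fst (coding (shift 1 u)) = t"
    by (simp add: coding_def shift_def t_def add.commute)
  have "(\<lambda>n. real (u (- int (Suc n) + 1)) / 2 ^ (n + 1)) = (\<lambda>n. real (u (- int n)) / 2 ^ (n + 1))"
    by simp
  then have sy: "snd (coding (shift 1 u)) = (real (u 1) + y) / 2"
    using suminf_binary_Suc[of "\<lambda>n. u (- int n + 1)", OF u1]
    by (simp add: coding_def shift_def y_def)
  have y: "snd (coding u) = y" by (simp add: coding_def y_def)
  have t0: "0 \<le> t"
    unfolding t_def using summable_binary[of "\<lambda>n. u (int n + 2)", OF u1]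
    by (intro suminf_nonneg) auto
  have t1: "t < 1" if "u 1 = 0"
  proof -
    from that tail obtain n where "n \<ge> 2" "u n = 0" by auto
    then have "u (int (nat (n - 2)) + 2) = 0" by simp
    then show ?thesis
      unfolding t_def using suminf_binary_less_1[of "\<lambda>n. u (int n + 2)", OF u1] by blast
  qed
  have "coding u = ((real (u 1) + t) / 2, y)"
    using x y by (simp add: prod_eq_iff)
  moreover have "coding (shift 1 u) = (t, (real (u 1) + y) / 2)"
    using sx sy by (simp add: prod_eq_iff)
  ultimately show ?thesis
    using u01[of 1] t0 t1 by (auto simp: baker_def field_simps)
qed

lemma binary_expansion:
  fixes d :: "nat \<Rightarrow> nat" and w :: "nat \<Rightarrow> real"
  assumes w: "\<And>n. w n = (real (d n) + w (Suc n)) / 2" "\<And>n. 0 \<le> w n" "\<And>n. w n \<le> 1"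
  shows "(\<Sum>n. real (d n) / 2 ^ (n + 1)) = w 0"
proof (rule sums_unique[symmetric])
  have p: "(\<Sum>i<n. real (d i) / 2 ^ (i + 1)) = w 0 - w n / 2 ^ n" for n
  proof (induction n)
    case (Suc n)
    then show ?case using w(1)[of n] by (simp add: field_simps)
  qed simp
  have "(\<lambda>n. w n / 2 ^ n) \<longlonglongrightarrow> 0"
  proof (rule tendsto_sandwich[where f = "\<lambda>_. 0" and h = "\<lambda>n. (1/2) ^ n"])
    show "(\<lambda>n. (1/2 :: real) ^ n) \<longlonglongrightarrow> 0" by (rule LIMSEQ_power_zero) simp
    show "\<forall>\<^sub>F n in sequentially. w n / 2 ^ n \<le> (1/2) ^ n"
      using w(3) by (intro always_eventually allI) (simp add: power_divide divide_right_mono)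
    show "\<forall>\<^sub>F n in sequentially. 0 \<le> w n / 2 ^ n"
      using w(2) by (intro always_eventually allI) simp
  qed simp
  then have "(\<lambda>n. w 0 - w n / 2 ^ n) \<longlonglongrightarrow> w 0 - 0" by (intro tendsto_diff tendsto_const)
  then show "(\<lambda>n. real (d n) / 2 ^ (n + 1)) sums w 0" unfolding sums_def p by simp
qed

text \<open>Every bi-infinite orbit of \<open>baker\<close> itself that avoids \<open>H\<close> runs inside the survivor set.\<close>

lemma baker_orbit_in_survivor_set:
  fixes z :: "int \<Rightarrow> real \<times> real"
  assumes z: "\<And>n. z n \<in> unit_square" "\<And>n. z (n + 1) = baker (z n)" "\<And>n. z n \<notin> H"
  shows "z k \<in> survivor_set H"
proof -
  define u :: "int \<Rightarrow> nat" where "u = (\<lambda>n. if fst (z (n - 1)) < 1/2 then 0 else 1)"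
  have step: "fst (z n) = (real (u (n + 1)) + fst (z (n + 1))) / 2 \<and>
    snd (z (n + 1)) = (real (u (n + 1)) + snd (z n)) / 2" for n
    using z(2)[of n] by (cases "z n") (simp add: u_def baker_def)
  have bd: "0 \<le> fst (z n)" "fst (z n) \<le> 1" "0 \<le> snd (z n)" "snd (z n) \<le> 1" for n
    using z(1)[of n] by (auto simp: unit_square_def mem_Times_iff)
  have c: "coding (shift m u) = z m" for m
  proof (rule prod_eqI)
    show "fst (coding (shift m u)) = fst (z m)"
      using binary_expansion[of "\<lambda>n. fst (z (int n + m))" "\<lambda>n. u (int n + 1 + m)"]
        step[of "int n + m" for n] bd
      by (simp add: coding_def shift_def algebra_simps)
    have "snd (z (- int n + m)) = (real (u (- int n + m)) + snd (z (- int (Suc n) + m))) / 2" for n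
      using step[of "- int (Suc n) + m"] by (simp add: algebra_simps)
    then show "snd (coding (shift m u)) = snd (z m)"
      using binary_expansion[of "\<lambda>n. snd (z (- int n + m))" "\<lambda>n. u (- int n + m)"] bd
      by (simp add: coding_def shift_def)
  qed
  have "z k = coding (shift k u)" by (simp add: c)
  moreover have "shift k u \<in> binary_seqs" by (simp add: binary_seqs_def shift_def u_def)
  moreover have "coding (shift n (shift k u)) \<notin> H" for n by (simp add: shift_add c z(3))
  ultimately show ?thesis unfolding survivor_set_def by blast
qed

end

theory Submission
  imports Defs
begin

text \<open>
  At an occurrence of \<open>01\<close> in a sequence, let \<open>y\<close> be the value of the past read backwards and \<open>z\<close> that
  of the future. Avoiding the parallelogram means \<open>y \<le> 1 - z\<close> or \<open>y \<ge> (1 + z) / 2\<close>, and the same holds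
  at \<open>10\<close> after exchanging the digits. Except when a sequence is eventually constant in both
  directions, this is a lexicographic condition, and it makes the run lengths essentially
  nonincreasing: a run of length \<open>r \<ge> 2\<close> is followed by a run of length at most \<open>r\<close>, possibly after a
  single run of length \<open>1\<close>, and two consecutive runs of length \<open>1\<close> force all later ones to have
  length \<open>1\<close>. While the length \<open>r\<close> of the long runs is constant, the runs of length \<open>1\<close> sit between
  them in a pattern of period dividing \<open>6\<close>.

  So the future is eventually periodic, which leaves countably many first coordinates. The past is
  eventually periodic as well, or its long runs grow without bound. In the second case all far windows
  of length \<open>K\<close> contain at most two changes, hence show at most \<open>2 (K + 1)\<^sup>2\<close> words, and for large \<open>K\<close>
  this is less than \<open>2 powr (K * s)\<close>.
\<close>

section \<open>Hausdorff null sets\<close>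

text \<open>An epsilon form of vanishing \<open>s\<close>-dimensional measure: covers can be built
  explicitly, without handling the infimum and supremum in \<open>hausdorff_measure\<close>.\<close>

definition hausdorff_null :: "real \<Rightarrow> 'a::metric_space set \<Rightarrow> bool" where
  "hausdorff_null s A \<longleftrightarrow> (\<forall>\<delta>>0. \<forall>\<epsilon>>0. \<exists>U. A \<subseteq> (\<Union>i::nat. U i) \<and>
     (\<forall>i. bounded (U i) \<and> diameter (U i) \<le> \<delta>) \<and> (\<Sum>i. diam_power s (U i)) \<le> ennreal \<epsilon>)"

lemma hausdorff_measure_null:
  assumes "hausdorff_null s A"
  shows "hausdorff_measure s A = 0"
proof -
  have "hausdorff_content s \<delta> A \<le> 0" if \<delta>: "\<delta> > 0" for \<delta>
  proof (rule ennreal_le_epsilon)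
    fix e :: real assume "0 < e"
    then obtain U where "A \<subseteq> (\<Union>i::nat. U i)" "\<forall>i. bounded (U i) \<and> diameter (U i) \<le> \<delta>"
      and le: "(\<Sum>i. diam_power s (U i)) \<le> ennreal e"
      using assms \<delta> unfolding hausdorff_null_def by meson
    then have "hausdorff_content s \<delta> A \<le> (\<Sum>i. diam_power s (U i))"
      unfolding hausdorff_content_def by (intro INF_lower) auto
    with le show "hausdorff_content s \<delta> A \<le> 0 + ennreal e" by simp
  qed
  then have "hausdorff_measure s A \<le> 0"
    unfolding hausdorff_measure_def by (intro SUP_least) auto
  then show ?thesis by simp
qed

lemma hausdorff_null_subset:
  assumes "hausdorff_null s B" "A \<subseteq> B"
  shows "hausdorff_null s A"
  using assms unfolding hausdorff_null_def by (meson subset_trans)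

text \<open>Each \<open>A n\<close> is covered at cost \<epsilon> / 2^(n+1), a geometric series with
  sum \<epsilon>; \<open>prod_decode\<close> turns the double family of covers into a single
  one.\<close>

lemma hausdorff_null_UN_nat:
  fixes A :: "nat \<Rightarrow> 'a::metric_space set"
  assumes "\<And>n. hausdorff_null s (A n)"
  shows "hausdorff_null s (\<Union>n. A n)"
  unfolding hausdorff_null_def
proof (intro allI impI)
  fix \<delta> \<epsilon> :: real assume \<delta>: "\<delta> > 0" and \<epsilon>: "\<epsilon> > 0"
  have "\<exists>U. A n \<subseteq> (\<Union>i::nat. U i) \<and>
     (\<forall>i. bounded (U i) \<and> diameter (U i) \<le> \<delta>) \<and>
     (\<Sum>i. diam_power s (U i)) \<le> ennreal (\<epsilon> * (1/2) ^ Suc n)" for n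
    using assms[of n] \<delta> \<epsilon> unfolding hausdorff_null_def by simp
  then obtain V where V: "\<And>n. A n \<subseteq> (\<Union>i::nat. V n i)"
    "\<And>n i. bounded (V n i) \<and> diameter (V n i) \<le> \<delta>"
    "\<And>n. (\<Sum>i. diam_power s (V n i)) \<le> ennreal (\<epsilon> * (1/2) ^ Suc n)"
    by metis
  define U where "U = (\<lambda>k. V (fst (prod_decode k)) (snd (prod_decode k)))"
  have "(\<Sum>k. diam_power s (U k)) = (\<Sum>n. \<Sum>i. diam_power s (V n i))"
    using suminf_ennreal_2dimen[of "\<lambda>n. \<Sum>i. diam_power s (V n i)"
        "\<lambda>(n, i). diam_power s (V n i)"]
    by (simp add: U_def case_prod_unfold)
  also have "\<dots> \<le> (\<Sum>n. ennreal (\<epsilon> * (1/2) ^ Suc n))"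
    by (intro suminf_le V(3)) auto
  also have "\<dots> = ennreal (\<Sum>n. \<epsilon> * (1/2) ^ Suc n)"
    using \<epsilon> by (intro suminf_ennreal2 summable_mult sums_summable[OF power_half_series]) auto
  also have "(\<Sum>n. \<epsilon> * (1/2 :: real) ^ Suc n) = \<epsilon>"
    using sums_unique[OF sums_mult[OF power_half_series, of \<epsilon>]] by simp
  finally have "(\<Sum>k. diam_power s (U k)) \<le> ennreal \<epsilon>" .
  moreover have "(\<Union>n. A n) \<subseteq> (\<Union>k. U k)"
  proof
    fix z assume "z \<in> (\<Union>n. A n)"
    then obtain n i where "z \<in> V n i" using V(1) by blast
    then have "z \<in> U (prod_encode (n, i))" by (simp add: U_def)
    then show "z \<in> (\<Union>k. U k)" by blast
  qed
  moreover have "bounded (U k) \<and> diameter (U k) \<le> \<delta>" for k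
    unfolding U_def by (rule V(2))
  ultimately show "\<exists>U. (\<Union>n. A n) \<subseteq> (\<Union>i::nat. U i) \<and>
     (\<forall>i. bounded (U i) \<and> diameter (U i) \<le> \<delta>) \<and> (\<Sum>i. diam_power s (U i)) \<le> ennreal \<epsilon>"
    by blast
qed

lemma hausdorff_null_empty: "hausdorff_null s {}"
  unfolding hausdorff_null_def
  by (intro allI impI exI[of _ "\<lambda>_. {}"]) (auto simp: diam_power_def)

lemma hausdorff_null_UN:
  assumes "countable I" "\<And>i. i \<in> I \<Longrightarrow> hausdorff_null s (A i)"
  shows "hausdorff_null s (\<Union>i\<in>I. A i)"
proof (cases "I = {}")
  case False
  then have "range (from_nat_into I) = I" by (rule range_from_nat_into[OF _ assms(1)])
  then have "A ` I = range (\<lambda>n. A (from_nat_into I n))"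
    using image_image[of A "from_nat_into I" UNIV] by simp
  then show ?thesis
    using hausdorff_null_UN_nat[of s "\<lambda>n. A (from_nat_into I n)"]
      assms(2) from_nat_into[OF False] by simp
qed (simp add: hausdorff_null_empty)

text \<open>Box-counting form: finitely many sets under one diameter bound \<open>r\<close>. The
  value \<open>r = 0\<close> is allowed, so single points are included, since
  \<open>0 powr s = 0\<close>.\<close>

lemma hausdorff_null_finite_covers:
  fixes A :: "'a::metric_space set"
  assumes s: "s > 0"
    and cov: "\<And>\<delta> \<epsilon>. \<delta> > 0 \<Longrightarrow> \<epsilon> > 0 \<Longrightarrow> \<exists>C r. finite C \<and> A \<subseteq> \<Union>C \<and> 0 \<le> r \<and> r \<le> \<delta> \<and>
      (\<forall>V\<in>C. bounded V \<and> diameter V \<le> r) \<and> card C * r powr s \<le> \<epsilon>"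
  shows "hausdorff_null s A"
  unfolding hausdorff_null_def
proof (intro allI impI)
  fix \<delta> \<epsilon> :: real assume \<delta>: "\<delta> > 0" and \<epsilon>: "\<epsilon> > 0"
  obtain C r where C: "finite C" "A \<subseteq> \<Union>C" "0 \<le> r" "r \<le> \<delta>"
    "\<And>V. V \<in> C \<Longrightarrow> bounded V \<and> diameter V \<le> r" "card C * r powr s \<le> \<epsilon>"
    using cov[OF \<delta> \<epsilon>] by blast
  obtain h where h: "bij_betw h {0..<card C} C"
    using ex_bij_betw_nat_finite[OF C(1)] by blast
  define U where "U = (\<lambda>i. if i < card C then h i else {})"
  have hC: "h i \<in> C" if "i < card C" for i
    using h that by (auto simp: bij_betw_def)
  have "(\<Sum>i. diam_power s (U i)) = (\<Sum>i<card C. diam_power s (U i))"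
    by (rule suminf_finite) (auto simp: U_def diam_power_def)
  also have "\<dots> \<le> (\<Sum>i<card C. ennreal (r powr s))"
    using C(5)[OF hC] s
    by (intro sum_mono) (auto simp: U_def diam_power_def diameter_ge_0 intro!: ennreal_leI powr_mono2)
  also have "\<dots> = ennreal (card C * r powr s)"
    by (simp add: ennreal_mult ennreal_of_nat_eq_real_of_nat)
  also have "\<dots> \<le> ennreal \<epsilon>" by (intro ennreal_leI C(6))
  finally have 1: "(\<Sum>i. diam_power s (U i)) \<le> ennreal \<epsilon>" .
  have "h ` {0..<card C} = C" using h by (simp add: bij_betw_def)
  then have "\<exists>i. z \<in> U i" if "z \<in> A" for z
    using C(2) that unfolding U_def by (metis (no_types, lifting) UnionE atLeastLessThan_iff imageE subsetD)
  then have 2: "A \<subseteq> (\<Union>i. U i)" by blast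
  have 3: "bounded (U i) \<and> diameter (U i) \<le> \<delta>" for i
    using C(5)[OF hC, of i] C(4) \<delta> by (auto simp: U_def)
  show "\<exists>U. A \<subseteq> (\<Union>i::nat. U i) \<and>
     (\<forall>i. bounded (U i) \<and> diameter (U i) \<le> \<delta>) \<and> (\<Sum>i. diam_power s (U i)) \<le> ennreal \<epsilon>"
    using 1 2 3 by blast
qed

lemma hausdorff_null_singleton:
  assumes "s > 0"
  shows "hausdorff_null s {z}"
  by (rule hausdorff_null_finite_covers[OF assms], rule exI[of _ "{{z}}"], rule exI[of _ 0])
    (use assms in auto)

lemma hausdorff_null_countable:
  assumes "s > 0" "countable A"
  shows "hausdorff_null s A"
  using hausdorff_null_UN[OF assms(2), of s "\<lambda>z. {z}", OF hausdorff_null_singleton[OF assms(1)]] by simp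

lemma hausdorff_dim_eq_0:
  assumes "\<And>s. s > 0 \<Longrightarrow> hausdorff_null s A"
  shows "hausdorff_dim A = 0"
proof (rule antisym)
  show "hausdorff_dim A \<le> 0"
  proof (rule ereal_le_epsilon2)
    fix e :: real assume "0 < e"
    then have "hausdorff_dim A \<le> ereal e"
      unfolding hausdorff_dim_def using hausdorff_measure_null[OF assms] by (intro INF_lower) auto
    then show "hausdorff_dim A \<le> 0 + ereal e" by simp
  qed
  show "0 \<le> hausdorff_dim A"
    unfolding hausdorff_dim_def by (intro INF_greatest) auto
qed

section \<open>Values of binary expansions\<close>

text \<open>Boolean digits turn the exchange of 0 and 1 into negation, which acts on values as t ->
  1 - t.\<close>

definition binval :: "(nat \<Rightarrow> bool) \<Rightarrow> real" where
  "binval v = (\<Sum>n. of_bool (v n) / 2 ^ (n + 1))"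

lemma summable_binval: "summable (\<lambda>n. of_bool (v n) / 2 ^ (n + 1) :: real)"
  using summable_binary[of "\<lambda>n. of_bool (v n)"] by simp

lemma binval_nonneg: "0 \<le> binval v"
  unfolding binval_def by (intro suminf_nonneg summable_binval) auto

lemma binval_not: "binval (\<lambda>n. \<not> v n) = 1 - binval v"
proof -
  have "binval v + binval (\<lambda>n. \<not> v n) = (\<Sum>n. 1 / 2 ^ (n + 1))"
    unfolding binval_def suminf_add[OF summable_binval summable_binval]
    by (intro suminf_cong) auto
  also have "\<dots> = 1"
    using sums_unique[OF power_half_series] by (simp add: power_divide)
  finally show ?thesis by simp
qed

lemma binval_le_1: "binval v \<le> 1"
  using binval_nonneg[of "\<lambda>n. \<not> v n"] by (simp add: binval_not)

lemma binval_eq_0: "binval v = 0 \<longleftrightarrow> (\<forall>n. \<not> v n)"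
  unfolding binval_def by (subst suminf_eq_zero_iff[OF summable_binval]) auto

lemma binval_split:
  "binval v = (\<Sum>i<k. of_bool (v i) / 2 ^ (i + 1)) + binval (\<lambda>i. v (i + k)) / 2 ^ k"
proof -
  have "binval v = (\<Sum>i. of_bool (v (i + k)) / 2 ^ (i + k + 1)) + (\<Sum>i<k. of_bool (v i) / 2 ^ (i + 1))"
    unfolding binval_def by (rule suminf_split_initial_segment[OF summable_binval])
  also have "(\<Sum>i. of_bool (v (i + k)) / 2 ^ (i + k + 1) :: real) =
      (\<Sum>i. of_bool (v (i + k)) / 2 ^ (i + 1) / 2 ^ k)"
    by (intro suminf_cong) (simp add: power_add)
  also have "\<dots> = binval (\<lambda>i. v (i + k)) / 2 ^ k"
    unfolding binval_def by (rule suminf_divide[OF summable_binval])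
  finally show ?thesis by simp
qed

lemma binval_Suc: "binval v = (of_bool (v 0) + binval (\<lambda>i. v (Suc i))) / 2"
  using binval_split[of v 1] by simp

text \<open>A lexicographic descent can only be compensated by the two expansions of a dyadic number.\<close>

lemma binval_le_lex:
  assumes le: "binval v \<le> binval w" and eq: "\<And>i. i < k \<Longrightarrow> v i = w i" and k: "v k" "\<not> w k"
  shows "(\<forall>i>k. \<not> v i) \<and> (\<forall>i>k. w i)"
proof -
  let ?v = "\<lambda>i. v (i + Suc k)" and ?w = "\<lambda>i. w (i + Suc k)"
  have "(\<Sum>i<k. of_bool (v i) / 2 ^ (i + 1) :: real) = (\<Sum>i<k. of_bool (w i) / 2 ^ (i + 1))"
    using eq by (intro sum.cong) auto
  with le k have "1 / 2 ^ Suc k + binval ?v / 2 ^ Suc k \<le> binval ?w / 2 ^ Suc k"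
    unfolding binval_split[of v "Suc k"] binval_split[of w "Suc k"] by simp
  then have "1 + binval ?v \<le> binval ?w"
    by (simp add: divide_simps)
  \<comment> \<open>Both tails have values in [0, 1], so the inequality leaves only 0 for
    \<open>?v\<close> and 1 for \<open>?w\<close>.\<close>
  then have "binval ?v = 0" "binval (\<lambda>i. \<not> ?w i) = 0"
    using binval_nonneg[of ?v] binval_le_1[of ?w] by (auto simp: binval_not)
  then have "\<not> v (i + Suc k)" "w (i + Suc k)" for i
    unfolding binval_eq_0 by auto
  then show ?thesis by (metis Suc_leI add.commute le_Suc_ex)
qed

section \<open>Run lengths\<close>

lemma nat_offset_mod:
  fixes i j d :: nat
  assumes "i \<le> j" "0 < d"
  obtains k t where "j = i + d * k + t" "t < d"
  using assms that[of "(j - i) div d" "(j - i) mod d"] by simp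

text \<open>
  The letters encode whether a gap has the eventual length \<open>r \<ge> 2\<close> or is \<open>1\<close>; the conditions leave
  only tails of the words \<open>rrr\<dots>\<close>, \<open>rr1rr1\<dots>\<close> and \<open>r1r1\<dots>\<close>.
\<close>

lemma forward_two_letters:
  fixes e :: "nat \<Rightarrow> bool"
  assumes no11: "\<And>i. i \<ge> N \<Longrightarrow> e i \<or> e (i + 1)"
    and e4: "\<And>i. i \<ge> N \<Longrightarrow> e i \<Longrightarrow> e (i + 1) \<Longrightarrow> e (i + 2) \<Longrightarrow> e (i + 3)"
    and e5: "\<And>i. i \<ge> N \<Longrightarrow> e i \<Longrightarrow> e (i + 1) \<Longrightarrow> \<not> e (i + 2) \<Longrightarrow> e (i + 3) \<Longrightarrow> e (i + 4)"
  shows "\<exists>M. \<forall>i\<ge>M. e (i + 6) = e i"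
proof (cases "\<exists>i\<ge>N. e i \<and> e (i + 1) \<and> e (i + 2)")
  case True
  then obtain i where i: "i \<ge> N" "e i" "e (i + 1)" "e (i + 2)" by blast
  have "e (i + k) \<and> e (i + k + 1) \<and> e (i + k + 2)" for k
  proof (induction k)
    case (Suc k)
    then show ?case using e4[of "i + k"] i(1) by (simp add: numeral_eq_Suc)
  qed (use i in simp)
  then have "e j" if "j \<ge> i" for j
    using le_Suc_ex[OF that] by blast
  then show ?thesis by (intro exI[of _ i]) simp
next
  case no3: False
  show ?thesis
  \<comment> \<open>Without \<open>rrr\<close>, a block \<open>rr\<close> starts the pattern
    \<open>rr1rr1\<close>, and without \<open>rr\<close> the letters alternate; 6 is a common
    multiple of the periods 1, 3 and 2.\<close>
  proof (cases "\<exists>i\<ge>N. e i \<and> e (i + 1)")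
    case True
    then obtain i where i: "i \<ge> N" "e i" "e (i + 1)" by blast
    have P: "e (i + 3 * k) \<and> e (i + 3 * k + 1) \<and> \<not> e (i + 3 * k + 2)" for k
    proof (induction k)
      case 0
      then show ?case using no3 i by auto
    next
      case (Suc k)
      let ?j = "i + 3 * k"
      have N: "?j \<ge> N" using i(1) by simp
      have "e (?j + 3)" using no11[of "?j + 2"] Suc N by (simp add: numeral_eq_Suc)
      moreover have "e (?j + 4)" using e5[of ?j] Suc N calculation by simp
      moreover have "\<not> e (?j + 5)"
        using no3 N calculation by (auto simp: numeral_eq_Suc dest!: spec[of _ "?j + 3"])
      ultimately show ?case by (simp add: numeral_eq_Suc)
    qed
    have "e (j + 6) = e j" if ij: "j \<ge> i" for j
    proof -
      obtain k t where j: "j = i + 3 * k + t" "t < 3"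
        using nat_offset_mod[OF ij, of 3] by auto
      from j(2) consider "t = 0" | "t = 1" | "t = 2" by linarith
      then show ?thesis
        using P[of k] P[of "k + 2"] by cases (simp_all add: j(1) add.commute add.left_commute numeral_eq_Suc)
    qed
    then show ?thesis by blast
  next
    case False
    then have "e (j + 1) = (\<not> e j)" if "j \<ge> N" for j
      using no11[OF that] that by blast
    then have "e (j + 6) = e j" if "j \<ge> N" for j
      using that by (simp add: numeral_eq_Suc)
    then show ?thesis by blast
  qed
qed

text \<open>The same restrictions read against the index, so they act through their contrapositives:
  a block \<open>1r1\<close> forces \<open>1r1r1\<close> and so on; without such blocks a letter
  \<open>1\<close> forces \<open>1rr1rr\<close>; otherwise only \<open>r\<close> remains.\<close>

lemma backward_two_letters:
  fixes e :: "nat \<Rightarrow> bool"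
  assumes no11: "\<And>i. i \<ge> N \<Longrightarrow> e i \<or> e (i + 1)"
    and e4: "\<And>i. i \<ge> N \<Longrightarrow> e (i + 3) \<Longrightarrow> e (i + 2) \<Longrightarrow> e (i + 1) \<Longrightarrow> e i"
    and e5: "\<And>i. i \<ge> N \<Longrightarrow> e (i + 4) \<Longrightarrow> e (i + 3) \<Longrightarrow> \<not> e (i + 2) \<Longrightarrow> e (i + 1) \<Longrightarrow> e i"
  shows "\<exists>M. \<forall>i\<ge>M. e (i + 6) = e i"
proof (cases "\<exists>i\<ge>N. \<not> e i \<and> \<not> e (i + 2)")
  case True
  then obtain i where i: "i \<ge> N" "\<not> e i" "\<not> e (i + 2)" by blast
  have P: "\<not> e (i + 2 * k) \<and> e (i + 2 * k + 1) \<and> \<not> e (i + 2 * k + 2)" for k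
  proof (induction k)
    case 0
    then show ?case using no11[of i] i by auto
  next
    case (Suc k)
    let ?j = "i + 2 * k"
    have N: "?j \<ge> N" using i(1) by simp
    have "e (?j + 3)" using no11[of "?j + 2"] Suc N by (simp add: numeral_eq_Suc)
    moreover have "\<not> e (?j + 4)" using e5[of ?j] Suc N calculation by auto
    ultimately show ?case using Suc by (simp add: numeral_eq_Suc)
  qed
  have "e (j + 6) = e j" if ij: "j \<ge> i" for j
  proof -
    obtain k t where j: "j = i + 2 * k + t" "t < 2"
      using nat_offset_mod[OF ij, of 2] by auto
    from j(2) consider "t = 0" | "t = 1" by linarith
    then show ?thesis
      using P[of k] P[of "k + 3"] by cases (simp_all add: j(1) add.commute add.left_commute numeral_eq_Suc)
  qed
  then show ?thesis by blast
next
  case no010: False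
  show ?thesis
  proof (cases "\<exists>i\<ge>N. \<not> e i")
    case True
    then obtain i where i: "i \<ge> N" "\<not> e i" by blast
    have step: "e (j + 1) \<and> e (j + 2) \<and> \<not> e (j + 3)" if "j \<ge> N" "\<not> e j" for j
      using no11[of j] no010 e4[of j] that by blast
    have P: "\<not> e (i + 3 * k)" for k
    proof (induction k)
      case (Suc k)
      then show ?case using step[of "i + 3 * k"] i(1) by (simp add: add.commute add.left_commute)
    qed (use i in simp)
    have P: "\<not> e (i + 3 * k) \<and> e (i + 3 * k + 1) \<and> e (i + 3 * k + 2)" for k
      using P step[of "i + 3 * k"] i(1) by auto
    have "e (j + 6) = e j" if ij: "j \<ge> i" for j
    proof -
      obtain k t where j: "j = i + 3 * k + t" "t < 3"
        using nat_offset_mod[OF ij, of 3] by auto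
      from j(2) consider "t = 0" | "t = 1" | "t = 2" by linarith
      then show ?thesis
        using P[of k] P[of "k + 2"] by cases (simp_all add: j(1) add.commute add.left_commute numeral_eq_Suc)
    qed
    then show ?thesis by blast
  next
    case False
    then show ?thesis by (intro exI[of _ N]) auto
  qed
qed

lemma nat_antimono_eventually_const:
  fixes m :: "nat \<Rightarrow> nat"
  assumes "\<And>i. m (Suc i) \<le> m i"
  shows "\<exists>N. \<forall>i\<ge>N. m i = m N"
proof -
  obtain N where N: "\<And>i. m N \<le> m i"
    using ex_has_least_nat[of "\<lambda>_. True" 0 m] by auto
  have "m i \<le> m N" if "i \<ge> N" for i
    using lift_Suc_antimono_le[of m N i] assms that by blast
  with N show ?thesis by (meson le_antisym)
qed

lemma nat_mono_bounded_eventually_const: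
  fixes m :: "nat \<Rightarrow> nat"
  assumes "\<And>i. i \<ge> N \<Longrightarrow> m i \<le> m (Suc i)" and "\<And>i. i \<ge> N \<Longrightarrow> m i \<le> B"
  shows "\<exists>M\<ge>N. \<forall>i\<ge>M. m i = m M"
proof -
  have "B - m (Suc i + N) \<le> B - m (i + N)" for i
    using assms(1)[of "i + N"] by (simp add: diff_le_mono2)
  then obtain M where M: "\<forall>i\<ge>M. B - m (i + N) = B - m (M + N)"
    using nat_antimono_eventually_const[of "\<lambda>i. B - m (i + N)"] by blast
  have "m i = m (M + N)" if "i \<ge> M + N" for i
  proof -
    have "B - m i = B - m (M + N)" using M[rule_format, of "i - N"] that by simp
    then show ?thesis using that assms(2)[of i] assms(2)[of "M + N"] by linarith
  qed
  then show ?thesis using le_add2 by blast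
qed

text \<open>
  Once no two consecutive gaps equal \<open>1\<close>, the maximum of two neighbouring gaps is monotone.
\<close>

lemma forward_gaps:
  fixes g :: "nat \<Rightarrow> nat"
  assumes g1: "\<And>i. 1 \<le> g i"
    and A1: "\<And>i. 2 \<le> g i \<Longrightarrow> g (i + 1) \<le> g i"
    and A2: "\<And>i. 2 \<le> g i \<Longrightarrow> g (i + 1) = 1 \<Longrightarrow> g (i + 2) \<le> g i"
    and A3: "\<And>i. g i = 1 \<Longrightarrow> g (i + 1) = 1 \<Longrightarrow> g (i + 2) = 1"
    and A4: "\<And>i. 2 \<le> g i \<Longrightarrow> 2 \<le> g (i + 1) \<Longrightarrow> g (i + 2) = g (i + 1) \<Longrightarrow> g (i + 3) \<noteq> 1"
    and A5: "\<And>i. 2 \<le> g i \<Longrightarrow> 2 \<le> g (i + 1) \<Longrightarrow> g (i + 2) = 1 \<Longrightarrow> g (i + 3) = g (i + 1) \<Longrightarrow> g (i + 4) \<noteq> 1"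
  shows "\<exists>N. \<forall>i\<ge>N. g (i + 6) = g i"
proof (cases "\<exists>i. g i = 1 \<and> g (i + 1) = 1")
  case True
  then obtain i where i: "g i = 1" "g (i + 1) = 1" by blast
  have "g (i + k) = 1 \<and> g (i + k + 1) = 1" for k
  proof (induction k)
    case (Suc k)
    then show ?case using A3[of "i + k"] by simp
  qed (use i in simp)
  then have "g j = 1" if "j \<ge> i" for j
    using le_Suc_ex[OF that] by blast
  then show ?thesis by (intro exI[of _ i]) simp
next
  case False
  then have no11: "2 \<le> g i \<or> 2 \<le> g (i + 1)" for i
    using g1[of i] g1[of "i + 1"] by (metis One_nat_def Suc_1 Suc_leI le_neq_implies_less)
  define m where "m = (\<lambda>i. max (g i) (g (i + 1)))"
  \<comment> \<open>If \<open>g (i + 1)\<close> is long, \<open>A1\<close> bounds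
    \<open>g (i + 2)\<close> by it; if it is 1, then \<open>g i\<close> is long and
    \<open>A2\<close> applies.\<close>
  have "m (Suc i) \<le> m i" for i
    using no11[of i] no11[of "Suc i"] A1[of i] A1[of "i + 1"] A2[of i] g1[of "i + 1"]
    unfolding m_def by fastforce
  then obtain N where N: "\<forall>i\<ge>N. m i = m N"
    using nat_antimono_eventually_const by blast
  define r where "r = m N"
  have r2: "2 \<le> r" using no11[of N] by (auto simp: r_def m_def)
  \<comment> \<open>By \<open>A1\<close> a long gap is at least its right neighbour, hence equals
    the maximum \<open>m i\<close>.\<close>
  have gr: "g i = r" if "i \<ge> N" "g i \<noteq> 1" for i
  proof -
    have "2 \<le> g i" using that(2) g1[of i] by linarith
    then have "m i = g i" using A1[of i] by (simp add: m_def)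
    then show ?thesis using N[rule_format, OF that(1)] by (simp add: r_def)
  qed
  have "\<exists>M. \<forall>i\<ge>M. (g (i + 6) = r) = (g i = r)"
  proof (rule forward_two_letters[of N])
    fix i assume i: "N \<le> i"
    show "g i = r \<or> g (i + 1) = r"
      using no11[of i] gr[of i] gr[of "i + 1"] i by (cases "g i = 1") simp_all
    show "g (i + 3) = r" if "g i = r" "g (i + 1) = r" "g (i + 2) = r"
      using A4[of i] that i r2 by (intro gr) simp_all
    show "g (i + 4) = r" if "g i = r" "g (i + 1) = r" "g (i + 2) \<noteq> r" "g (i + 3) = r"
      using A5[of i] that gr[of "i + 2"] i r2 by (intro gr) auto
  qed
  then obtain M where M: "\<forall>i\<ge>M. (g (i + 6) = r) = (g i = r)" by blast
  have "g (i + 6) = g i" if "i \<ge> max M N" for i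
  proof -
    have "(g (i + 6) = r) = (g i = r)" "g i = 1 \<or> g i = r" "g (i + 6) = 1 \<or> g (i + 6) = r"
      using that M[rule_format, of i] gr[of i] gr[of "i + 6"] by auto
    then show ?thesis by metis
  qed
  then show ?thesis by blast
qed

text \<open>Here the gaps are listed from right to left, so every hypothesis is one of
  \<open>forward_gaps\<close> reversed and the maximum of two neighbours becomes nondecreasing. If
  it is bounded it stabilises as before; if not, the second alternative arises.\<close>

lemma backward_gaps:
  fixes h :: "nat \<Rightarrow> nat"
  assumes h1: "\<And>i. 1 \<le> h i"
    and B1: "\<And>i. 2 \<le> h (i + 1) \<Longrightarrow> h i \<le> h (i + 1)"
    and B2: "\<And>i. 2 \<le> h (i + 2) \<Longrightarrow> h (i + 1) = 1 \<Longrightarrow> h i \<le> h (i + 2)"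
    and B3: "\<And>i. h (i + 2) = 1 \<Longrightarrow> h (i + 1) = 1 \<Longrightarrow> h i = 1"
    and B4: "\<And>i. 2 \<le> h (i + 3) \<Longrightarrow> 2 \<le> h (i + 2) \<Longrightarrow> h (i + 1) = h (i + 2) \<Longrightarrow> h i \<noteq> 1"
    and B5: "\<And>i. 2 \<le> h (i + 4) \<Longrightarrow> 2 \<le> h (i + 3) \<Longrightarrow> h (i + 2) = 1 \<Longrightarrow> h (i + 1) = h (i + 3) \<Longrightarrow> h i \<noteq> 1"
  shows "(\<exists>N. \<forall>i\<ge>N. h (i + 6) = h i) \<or>
    (\<forall>K. \<exists>N. \<forall>i\<ge>N. (h i = 1 \<longrightarrow> h (i + 1) \<noteq> 1) \<and> (h i = 1 \<or> K \<le> h i))"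
proof (cases "\<forall>N. \<exists>i\<ge>N. h i = 1 \<and> h (i + 1) = 1")
  case True
  \<comment> \<open>A pair of neighbouring gaps 1 spreads to all smaller indices, so pairs occurring
    arbitrarily far out make every gap 1.\<close>
  have down: "h j = 1" if "h (j + k) = 1" "h (j + k + 1) = 1" for j k
    using that
  proof (induction k)
    case (Suc k)
    then show ?case using B3[of "j + k"] by simp
  qed simp
  have "h j = 1" for j
  proof -
    obtain i where "i \<ge> j" "h i = 1" "h (i + 1) = 1" using True by blast
    then show ?thesis using down[of j "i - j"] by simp
  qed
  then show ?thesis by simp
next
  case False
  then obtain N where "\<And>i. i \<ge> N \<Longrightarrow> \<not> (h i = 1 \<and> h (i + 1) = 1)" by blast
  then have no11: "2 \<le> h i \<or> 2 \<le> h (i + 1)" if "i \<ge> N" for i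
    using h1[of i] h1[of "i + 1"] that by (metis One_nat_def Suc_1 Suc_leI le_neq_implies_less)
  define m where "m = (\<lambda>i. max (h i) (h (i + 1)))"
  have mono: "m i \<le> m (Suc i)" if "i \<ge> N" for i
    using no11[of i] no11[of "Suc i"] B1[of i] B1[of "i + 1"] B2[of i] h1[of "i + 1"] that
    unfolding m_def by fastforce
  have hm: "h (Suc i) = m i" if "i \<ge> N" "h (Suc i) \<noteq> 1" for i
  proof -
    have "2 \<le> h (Suc i)" using that(2) h1[of "Suc i"] by linarith
    then show ?thesis using B1[of i] by (simp add: m_def)
  qed
  show ?thesis
  proof (cases "\<exists>B. \<forall>i\<ge>N. m i \<le> B")
    case True
    then obtain B where "\<forall>i\<ge>N. m i \<le> B" by blast
    then obtain M where M: "M \<ge> N" "\<forall>i\<ge>M. m i = m M"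
      using nat_mono_bounded_eventually_const[of N m B] mono by auto
    define r where "r = m M"
    have r2: "2 \<le> r" using no11[OF M(1)] by (auto simp: r_def m_def)
    have hr: "h i = r" if "i > M" "h i \<noteq> 1" for i
      using hm[of "i - 1"] M(1) M(2)[rule_format, of "i - 1"] that unfolding r_def by (cases i) simp_all
    have "\<exists>L. \<forall>i\<ge>L. (h (i + 6) = r) = (h i = r)"
    proof (rule backward_two_letters[of "Suc M"])
      fix i assume i: "Suc M \<le> i"
      show "h i = r \<or> h (i + 1) = r"
        using no11[of i] hr[of i] hr[of "i + 1"] i M(1) by (cases "h i = 1") simp_all
      show "h i = r" if "h (i + 3) = r" "h (i + 2) = r" "h (i + 1) = r"
        using B4[of i] that i r2 by (intro hr) simp_all
      show "h i = r" if "h (i + 4) = r" "h (i + 3) = r" "h (i + 2) \<noteq> r" "h (i + 1) = r"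
        using B5[of i] that hr[of "i + 2"] i r2 by (intro hr) auto
    qed
    then obtain L where L: "\<forall>i\<ge>L. (h (i + 6) = r) = (h i = r)" by blast
    have "h (i + 6) = h i" if "i \<ge> max L (Suc M)" for i
    proof -
      have "(h (i + 6) = r) = (h i = r)" "h i = 1 \<or> h i = r" "h (i + 6) = 1 \<or> h (i + 6) = r"
        using that L[rule_format, of i] hr[of i] hr[of "i + 6"] by auto
      then show ?thesis by metis
    qed
    then show ?thesis by blast
  next
    case False
    have "\<exists>L. \<forall>i\<ge>L. (h i = 1 \<longrightarrow> h (i + 1) \<noteq> 1) \<and> (h i = 1 \<or> K \<le> h i)" for K
    proof -
      \<comment> \<open>Being nondecreasing, \<open>m\<close> stays at least \<open>K\<close> from
        here on, and by \<open>hm\<close> every later gap other than 1 is a value of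
        \<open>m\<close>.\<close>
      from False obtain M where "M \<ge> N" "\<not> m M \<le> K" by blast
      then have M: "M \<ge> N" "K \<le> m M" by simp_all
      have mK: "K \<le> m i" if "i \<ge> M" for i
        using that
      proof (induction i rule: dec_induct)
        case (step i)
        then show ?case using mono[of i] M(1) by linarith
      qed (use M in simp)
      have "h i = 1 \<or> K \<le> h i" if "i \<ge> Suc M" for i
      proof -
        obtain k where k: "i = Suc k" "k \<ge> M" using \<open>i \<ge> Suc M\<close> by (cases i) auto
        show ?thesis using hm[of k] mK[OF k(2)] k M(1) by (cases "h i = 1") simp_all
      qed
      moreover have "h i = 1 \<longrightarrow> h (i + 1) \<noteq> 1" if "i \<ge> Suc M" for i
        using no11[of i] that M(1) by auto
      ultimately show ?thesis by blast
    qed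
    then show ?thesis by blast
  qed
qed

section \<open>Changes of digit in admissible sequences\<close>

definition change :: "(int \<Rightarrow> bool) \<Rightarrow> int \<Rightarrow> bool" where
  "change u n \<longleftrightarrow> u n \<noteq> u (n + 1)"

text \<open>The digits at the positions from \<open>a + 1\<close> to \<open>b\<close> then form a
  maximal run, so its length is \<open>b - a\<close>.\<close>

definition consecutive_changes :: "(int \<Rightarrow> bool) \<Rightarrow> int \<Rightarrow> int \<Rightarrow> bool" where
  "consecutive_changes u a b \<longleftrightarrow> a < b \<and> change u a \<and> change u b \<and> (\<forall>n. a < n \<longrightarrow> n < b \<longrightarrow> \<not> change u n)"

text \<open>
  \<open>past u n\<close> and \<open>future u n\<close> are the digits outside the positions \<open>n\<close>, \<open>n + 1\<close> of a change, read
  outwards and complemented if \<open>u n\<close> holds, so that both kinds of change look like \<open>01\<close>.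
\<close>

definition past :: "(int \<Rightarrow> bool) \<Rightarrow> int \<Rightarrow> nat \<Rightarrow> bool" where
  "past u n i \<longleftrightarrow> u (n - 1 - int i) \<noteq> u n"

definition future :: "(int \<Rightarrow> bool) \<Rightarrow> int \<Rightarrow> nat \<Rightarrow> bool" where
  "future u n i \<longleftrightarrow> u (n + 2 + int i) \<noteq> u n"

text \<open>The lexicographic form of \<open>y \<le> 1 - z \<or> y \<ge> (1 + z) / 2\<close>.\<close>

definition avoids_lex :: "(nat \<Rightarrow> bool) \<Rightarrow> (nat \<Rightarrow> bool) \<Rightarrow> bool" where
  "avoids_lex y z \<longleftrightarrow>
     (\<forall>k. (\<forall>i<k. y i \<noteq> z i) \<longrightarrow> \<not> (y k \<and> z k)) \<or>
     (y 0 \<and> (\<forall>k. (\<forall>i<k. y (Suc i) = z i) \<longrightarrow> \<not> (z k \<and> \<not> y (Suc k))))"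

definition admissible :: "(int \<Rightarrow> bool) \<Rightarrow> bool" where
  "admissible u \<longleftrightarrow> (\<forall>n. change u n \<longrightarrow> avoids_lex (past u n) (future u n))"

text \<open>Both alternatives have to be refuted: the first fails at index \<open>k\<close>, the
  second either at the required leading digit \<open>y 0\<close> or at index
  \<open>l\<close>.\<close>

lemma not_avoids_lexI:
  assumes "\<And>i. i < k \<Longrightarrow> y i \<noteq> z i" "y k" "z k"
    and "\<not> y 0 \<or> (\<forall>i<l. y (Suc i) = z i) \<and> z l \<and> \<not> y (Suc l)"
  shows "\<not> avoids_lex y z"
  using assms unfolding avoids_lex_def by blast

lemma consecutive_changes_const:
  assumes ab: "consecutive_changes u a b" and n: "a < n" "n \<le> b"
  shows "u n = u b"
  using n(2,1)
proof (induction n rule: int_le_induct)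
  case (step i)
  then have "\<not> change u (i - 1)" using ab by (simp add: consecutive_changes_def)
  with step show ?case by (simp add: change_def)
qed simp

lemma consecutive_changesD:
  assumes ab: "consecutive_changes u a b"
  shows "a < b" "u a = (\<not> u b)" "u (b + 1) = (\<not> u b)"
    "\<And>n. a < n \<Longrightarrow> n \<le> b \<Longrightarrow> u n = u b"
proof -
  show "a < b" using ab by (simp add: consecutive_changes_def)
  then show "u a = (\<not> u b)"
    using consecutive_changes_const[OF ab, of "a + 1"] ab
    by (simp add: consecutive_changes_def change_def)
  show "u (b + 1) = (\<not> u b)" using ab by (auto simp: consecutive_changes_def change_def)
qed (rule consecutive_changes_const[OF ab])

lemma admissible_change:
  "admissible u \<Longrightarrow> consecutive_changes u a b \<Longrightarrow> avoids_lex (past u b) (future u b)"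
  by (simp add: admissible_def consecutive_changes_def)

section \<open>Run-length restrictions from the lexicographic condition\<close>

text \<open>Let r = b - a. With a longer next run, the change at \<open>b\<close> would have a past
  beginning 0^(r-1) 1 and a future beginning 1^r. The first alternative fails at index r - 1, the
  second at the leading digit, which is 0 because r is at least 2.\<close>

lemma long_run_long_run:
  assumes u: "admissible u" and ab: "consecutive_changes u a b" and bc: "consecutive_changes u b c"
    and r2: "2 \<le> b - a"
  shows "c - b \<le> b - a"
proof (rule ccontr)
  assume gt: "\<not> c - b \<le> b - a"
  note A = consecutive_changesD[OF ab] and B = consecutive_changesD[OF bc]
  define k where "k = nat (b - a - 1)"
  have k: "int k = b - a - 1" using r2 by (simp add: k_def)
  have y: "\<not> past u b i" if "i < k" for i
    unfolding past_def using that k A(4)[of "b - 1 - int i"] by simp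
  have yk: "past u b k"
    unfolding past_def using k A(2) by simp
  have z: "future u b i" if "i \<le> k" for i
    unfolding future_def using that k gt B(2) B(4)[of "b + 2 + int i"] by simp
  have "\<not> avoids_lex (past u b) (future u b)"
    using y yk z y[of 0] k r2 by (intro not_avoids_lexI[of k]) auto
  with admissible_change[OF u ab] show False by blast
qed

text \<open>Let r = b - a. At the change \<open>b + 1\<close> the past begins 1^r 0, and a run
  longer than r would make the future begin 1^r. The first alternative fails at index 0, the second
  when the past, stripped of its leading 1, drops below the future.\<close>

lemma long_run_single_long_run:
  assumes u: "admissible u" and ab: "consecutive_changes u a b"
    and bb: "consecutive_changes u b (b + 1)" and bc: "consecutive_changes u (b + 1) c"
    and r2: "2 \<le> b - a"
  shows "c - (b + 1) \<le> b - a"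
proof (rule ccontr)
  assume gt: "\<not> c - (b + 1) \<le> b - a"
  note A = consecutive_changesD[OF ab] and B = consecutive_changesD[OF bb]
    and C = consecutive_changesD[OF bc]
  define l where "l = nat (b - a - 1)"
  have l: "int l = b - a - 1" using r2 by (simp add: l_def)
  have y: "past u (b + 1) i" if "i \<le> l" for i
    unfolding past_def using that l B(2) A(4)[of "b + 1 - 1 - int i"] by simp
  have yl: "\<not> past u (b + 1) (Suc l)"
    unfolding past_def using l A(2) B(2) by simp
  have z: "future u (b + 1) i" if "i \<le> l" for i
    unfolding future_def using that l gt C(2) C(4)[of "b + 1 + 2 + int i"] by simp
  have "\<not> avoids_lex (past u (b + 1)) (future u (b + 1))"
    using y yl z by (intro not_avoids_lexI[of 0 _ _ l]) auto
  with admissible_change[OF u bb] show False by blast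
qed

text \<open>At the change \<open>a + 2\<close> the past begins 10. Without a change at
  \<open>a + 3\<close> the future would begin with 1, and both alternatives fail at index 0.\<close>

lemma two_singles:
  assumes u: "admissible u" and a: "change u a" "change u (a + 1)" "change u (a + 2)"
  shows "change u (a + 3)"
proof (rule ccontr)
  assume n: "\<not> change u (a + 3)"
  have "\<not> avoids_lex (past u (a + 2)) (future u (a + 2))"
    using a n by (intro not_avoids_lexI[of 0 _ _ 0]) (auto simp: past_def future_def change_def algebra_simps)
  with u a(3) show False by (simp add: admissible_def)
qed

text \<open>With k = c - b, the past at \<open>c\<close> begins 0^(k-1) 1 1, the last 1 because the
  run before \<open>b\<close> is long. A change at \<open>d + 1\<close> would give the future
  1^(k-1) 0 1: complementary up to index k, where both digits are 1.\<close>

lemma equal_long_runs_no_single: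
  assumes u: "admissible u" and ab: "consecutive_changes u a b"
    and bc: "consecutive_changes u b c" and cd: "consecutive_changes u c d"
    and r2: "2 \<le> b - a" "2 \<le> c - b" and eq: "d - c = c - b"
  shows "\<not> change u (d + 1)"
proof
  assume d1: "change u (d + 1)"
  note A = consecutive_changesD[OF ab] and B = consecutive_changesD[OF bc]
    and C = consecutive_changesD[OF cd]
  define k where "k = nat (c - b)"
  have k: "int k = c - b" using r2 by (simp add: k_def)
  have y: "\<not> past u c i" if "int i < int k - 1" for i
    unfolding past_def using that k B(4)[of "c - 1 - int i"] by simp
  have y1: "past u c i" if "int i = int k - 1" for i
    unfolding past_def using that k B(2) by simp
  have yk: "past u c k"
    unfolding past_def using k r2 B(2) A(4)[of "b - 1"] by simp
  have z: "future u c i" if "int i < int k - 1" for i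
    unfolding future_def using that k eq C(2) C(4)[of "c + 2 + int i"] by simp
  have d: "c + 2 + (int k - 1) = d + 1" "c + 2 + int k = d + 2" using k eq by simp_all
  have z1: "\<not> future u c i" if "int i = int k - 1" for i
    unfolding future_def that d using C(2,3) by simp
  have zk: "future u c k"
    unfolding future_def d using C(2,3) d1 by (simp add: change_def add.assoc)
  have "past u c i \<noteq> future u c i" if "i < k" for i
    using y[of i] y1[of i] z[of i] z1[of i] that by (cases "int i = int k - 1") auto
  then have "\<not> avoids_lex (past u c) (future u c)"
    using y[of 0] yk zk k r2 by (intro not_avoids_lexI[of k]) auto
  with admissible_change[OF u bc] show False by blast
qed

text \<open>With k = c - b, the past at \<open>c + 1\<close> begins 1^k 0 0, and a change at
  \<open>d + 1\<close> would give the future 1^(k-1) 0 1. After its leading 1 the past agrees with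
  the future in k digits and is then smaller; the first alternative fails at index 0.\<close>

lemma equal_long_runs_around_single_no_single:
  assumes u: "admissible u" and ab: "consecutive_changes u a b"
    and bc: "consecutive_changes u b c" and cc: "consecutive_changes u c (c + 1)"
    and cd: "consecutive_changes u (c + 1) d"
    and r2: "2 \<le> b - a" "2 \<le> c - b" and eq: "d - (c + 1) = c - b"
  shows "\<not> change u (d + 1)"
proof
  assume d1: "change u (d + 1)"
  note A = consecutive_changesD[OF ab] and B = consecutive_changesD[OF bc]
    and C = consecutive_changesD[OF cc] and D = consecutive_changesD[OF cd]
  define k where "k = nat (c - b)"
  have k: "int k = c - b" using r2 by (simp add: k_def)
  have y: "past u (c + 1) i" if "i < k" for i
    unfolding past_def using that k C(2) B(4)[of "c + 1 - 1 - int i"] by simp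
  have y1: "\<not> past u (c + 1) k"
    unfolding past_def using k B(2) C(2) by simp
  have yk: "\<not> past u (c + 1) (Suc k)"
    unfolding past_def using k r2 B(2) C(2) A(4)[of "b - 1"] by simp
  have z: "future u (c + 1) i" if "int i < int k - 1" for i
    unfolding future_def using that k eq D(2) D(4)[of "c + 1 + 2 + int i"] by simp
  have d: "c + 1 + 2 + (int k - 1) = d + 1" "c + 1 + 2 + int k = d + 2" using k eq by simp_all
  have z1: "\<not> future u (c + 1) i" if "int i = int k - 1" for i
    unfolding future_def that d using D(2,3) by simp
  have zk: "future u (c + 1) k"
    unfolding future_def d using D(2,3) d1 by (simp add: change_def add.assoc)
  have "past u (c + 1) (Suc i) = future u (c + 1) i" if "i < k" for i
  proof (cases "int i = int k - 1")
    case True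
    then have "Suc i = k" by simp
    with y1 z1[OF True] show ?thesis by simp
  next
    case False
    with that have "Suc i < k" by simp
    with y[of "Suc i"] z[of i] show ?thesis by simp
  qed
  then have "\<not> avoids_lex (past u (c + 1)) (future u (c + 1))"
    using y[of 0] z[of 0] yk zk k r2 by (intro not_avoids_lexI[of 0 _ _ k]) auto
  with admissible_change[OF u cc] show False by blast
qed

section \<open>Eventual periodicity from the gaps between changes\<close>

definition change_set :: "(nat \<Rightarrow> bool) \<Rightarrow> nat set" where
  "change_set v = {n. v n \<noteq> v (Suc n)}"

definition eventually_periodic :: "(nat \<Rightarrow> bool) \<Rightarrow> bool" where
  "eventually_periodic v \<longleftrightarrow> (\<exists>N P. 0 < P \<and> (\<forall>n\<ge>N. v (n + P) = v n))"

text \<open>Changes determine a sequence up to complement, so from \<open>N\<close> on the shift by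
  \<open>P\<close> either preserves all digits or complements all of them. In both cases
  \<open>2 * P\<close> is a period.\<close>

lemma eventually_periodic_change_set:
  assumes P: "0 < P" and per: "\<And>n. n \<ge> N \<Longrightarrow> n + P \<in> change_set v \<longleftrightarrow> n \<in> change_set v"
  shows "eventually_periodic v"
proof -
  have "(v (N + k + P) = v (N + k)) = (v (N + P) = v N)" for k
  proof (induction k)
    case (Suc k)
    then show ?case using per[of "N + k"] by (auto simp: change_set_def)
  qed simp
  then have eq: "(v (n + P) = v n) = (v (N + P) = v N)" if "n \<ge> N" for n
    using le_Suc_ex[OF that] by blast
  have "v (n + 2 * P) = v n" if "n \<ge> N" for n
    using eq[of n] eq[of "n + P"] that by (auto simp: mult_2 add.assoc)
  with P show ?thesis unfolding eventually_periodic_def by (intro exI[of _ N] exI[of _ "2 * P"]) simp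
qed

lemma eventually_periodic_finite_changes:
  assumes "finite (change_set v)"
  shows "eventually_periodic v"
proof -
  obtain N where "\<forall>n\<in>change_set v. n < N"
    using assms finite_nat_set_iff_bounded by blast
  then show ?thesis by (intro eventually_periodic_change_set[of 1 N]) fastforce+
qed

definition gap :: "nat set \<Rightarrow> nat \<Rightarrow> nat" where
  "gap S i = enumerate S (Suc i) - enumerate S i"

lemma enumerate_add_gap:
  assumes "infinite S"
  shows "enumerate S (Suc i) = enumerate S i + gap S i" "1 \<le> gap S i"
  using enumerate_step[OF assms, of i] by (auto simp: gap_def)

lemma enumerate_between:
  fixes S :: "nat set"
  assumes inf: "infinite S" and m: "enumerate S i < m" "m < enumerate S (Suc i)"
  shows "m \<notin> S"
proof
  assume "m \<in> S"
  then obtain j where j: "enumerate S j = m" using enumerate_Ex[OF inf] by blast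
  then have "i < j" "j < Suc i" 
    using m j enumerate_mono_iff[OF inf, of i j] enumerate_mono_iff[OF inf, of j "Suc i"] by simp_all
  then show False by simp
qed

text \<open>Periodic gaps make a tail of the change set invariant under translation by
  \<open>P\<close>, the sum of \<open>q\<close> consecutive gaps.\<close>

lemma eventually_periodic_gaps:
  assumes inf: "infinite (change_set v)"
    and per: "\<And>i. i \<ge> N \<Longrightarrow> gap (change_set v) (i + q) = gap (change_set v) i" and q: "0 < q"
  shows "eventually_periodic v"
proof -
  let ?p = "enumerate (change_set v)"
  define P where "P = ?p (N + q) - ?p N"
  have "?p N < ?p (N + q)" using enumerate_mono[OF _ inf, of N "N + q"] q by simp
  then have P: "0 < P" "?p (N + q) = ?p N + P" by (auto simp: P_def)
  have shift: "?p (N + k + q) = ?p (N + k) + P" for k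
  proof (induction k)
    case (Suc k)
    then show ?case
      using per[of "N + k"] enumerate_add_gap(1)[OF inf, of "N + k"]
        enumerate_add_gap(1)[OF inf, of "N + k + q"] by simp
  qed (simp add: P)
  have "n + P \<in> change_set v \<longleftrightarrow> n \<in> change_set v" if n: "n \<ge> ?p N" for n
  proof
    assume "n \<in> change_set v"
    then obtain i where i: "?p i = n" using enumerate_Ex[OF inf] by blast
    then have "N \<le> i" using n enumerate_mono_le_iff[OF inf, of N i] by simp
    then obtain k where "i = N + k" using le_Suc_ex by blast
    with shift[of k] i show "n + P \<in> change_set v"
      using enumerate_in_set[OF inf, of "N + k + q"] by simp
  next
    assume "n + P \<in> change_set v"
    then obtain j where j: "?p j = n + P" using enumerate_Ex[OF inf] by blast
    then have "?p (N + q) \<le> ?p j" using n P by simp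
    then have "N + q \<le> j" using enumerate_mono_le_iff[OF inf] by blast
    then obtain k where "j = N + q + k" using le_Suc_ex by blast
    then have "j = N + k + q" by simp
    with shift[of k] j show "n \<in> change_set v"
      using enumerate_in_set[OF inf, of "N + k"] by simp
  qed
  with P(1) show ?thesis by (rule eventually_periodic_change_set)
qed

section \<open>Gap sequences of the two halves of an admissible sequence\<close>

lemma admissible_future:
  assumes u: "admissible u"
  shows "eventually_periodic (\<lambda>n. u (int n + 1))"
proof (cases "finite (change_set (\<lambda>n. u (int n + 1)))")
  case True
  then show ?thesis by (rule eventually_periodic_finite_changes)
next
  case inf: False
  define S where "S = change_set (\<lambda>n. u (int n + 1))"
  have inf: "infinite S" using inf by (simp add: S_def)
  \<comment> \<open>Index \<open>n\<close> of the half-sequence is position \<open>n + 1\<close> of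
    \<open>u\<close>, hence the offset. The gap with index \<open>i\<close> is the length of the run
    that starts after \<open>e i\<close>.\<close>
  define e where "e i = int (enumerate S i) + 1" for i
  have S: "n \<in> S \<longleftrightarrow> change u (int n + 1)" for n
    by (simp add: S_def change_set_def change_def add.commute)
  have step: "e (i + 1) = e i + int (gap S i)" for i
    using enumerate_add_gap(1)[OF inf, of i] by (simp add: e_def)
  have ch: "change u (e i)" for i
    using enumerate_in_set[OF inf, of i] by (simp add: S e_def)
  have no: "\<not> change u n" if "e i < n" "n < e (i + 1)" for i n
  proof -
    have "enumerate S i < nat (n - 1)" "nat (n - 1) < enumerate S (Suc i)" and n: "int (nat (n - 1)) + 1 = n"
      using that by (simp_all add: e_def)
    then have "nat (n - 1) \<notin> S" by (intro enumerate_between[OF inf])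
    then show ?thesis unfolding S n .
  qed
  have con: "consecutive_changes u (e i) (e (i + 1))" for i
  proof -
    have "e i < e (i + 1)" using step[of i] enumerate_add_gap(2)[OF inf, of i] by simp
    then show ?thesis unfolding consecutive_changes_def using ch no by blast
  qed
  have con2: "consecutive_changes u (e (i + 1)) (e (i + 2))"
    and con3: "consecutive_changes u (e (i + 2)) (e (i + 3))"
    and con4: "consecutive_changes u (e (i + 3)) (e (i + 4))" for i
    using con[of "i + 1"] con[of "i + 2"] con[of "i + 3"] by (simp_all add: numeral_eq_Suc)
  have step2: "e (i + 2) = e (i + 1) + int (gap S (i + 1))"
    and step3: "e (i + 3) = e (i + 2) + int (gap S (i + 2))"
    and step4: "e (i + 4) = e (i + 3) + int (gap S (i + 3))"
    and step5: "e (i + 5) = e (i + 4) + int (gap S (i + 4))" for i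
    using step[of "i + 1"] step[of "i + 2"] step[of "i + 3"] step[of "i + 4"]
    by (simp_all add: numeral_eq_Suc)
  have "\<exists>N. \<forall>i\<ge>N. gap S (i + 6) = gap S i"
  proof (rule forward_gaps)
    fix i
    show "1 \<le> gap S i" by (rule enumerate_add_gap(2)[OF inf])
    show "gap S (i + 1) \<le> gap S i" if "2 \<le> gap S i"
      using long_run_long_run[OF u con con2, of i] that step[of i] step2[of i] by simp
    show "gap S (i + 2) \<le> gap S i" if "2 \<le> gap S i" "gap S (i + 1) = 1"
    proof -
      \<comment> \<open>This equation gives the short run the endpoints \<open>b\<close> and
        \<open>b + 1\<close> required by the lemma on a single run.\<close>
      have e: "e (i + 2) = e (i + 1) + 1" using step2[of i] that by simp
      show ?thesis
        using long_run_single_long_run[OF u con con2[of i, unfolded e] con3[of i, unfolded e]]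
          that step[of i] step3[of i] e by simp
    qed
    show "gap S (i + 2) = 1" if "gap S i = 1" "gap S (i + 1) = 1"
    proof (rule ccontr)
      assume "gap S (i + 2) \<noteq> 1"
      then have "2 \<le> gap S (i + 2)" using enumerate_add_gap(2)[OF inf, of "i + 2"] by linarith
      moreover have eq: "e (i + 2 + 1) = e (i + 3)" by (simp add: numeral_eq_Suc)
      ultimately have "\<not> change u (e i + 3)"
        using no[of "i + 2" "e i + 3", unfolded eq] step[of i] step2[of i] step3[of i] that by simp
      moreover have "e (i + 1) = e i + 1" "e (i + 2) = e i + 2" using step[of i] step2[of i] that by simp_all
      then have "change u (e i + 1)" "change u (e i + 2)" using ch by metis+
      ultimately show False using two_singles[OF u ch] by blast
    qed
    show "gap S (i + 3) \<noteq> 1" if "2 \<le> gap S i" "2 \<le> gap S (i + 1)" "gap S (i + 2) = gap S (i + 1)"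
    proof
      assume "gap S (i + 3) = 1"
      then have "change u (e (i + 3) + 1)" using ch[of "i + 4"] step4[of i] by simp
      moreover have "\<not> change u (e (i + 3) + 1)"
        by (rule equal_long_runs_no_single[OF u con con2 con3])
          (use that step[of i] step2[of i] step3[of i] in simp_all)
      ultimately show False by blast
    qed
    show "gap S (i + 4) \<noteq> 1" if "2 \<le> gap S i" "2 \<le> gap S (i + 1)" "gap S (i + 2) = 1"
      "gap S (i + 3) = gap S (i + 1)"
    proof -
      have e: "e (i + 3) = e (i + 2) + 1" using step3[of i] that by simp
      have no1: "\<not> change u (e (i + 4) + 1)"
        by (rule equal_long_runs_around_single_no_single
            [OF u con con2 con3[of i, unfolded e] con4[of i, unfolded e]])
          (use that e step[of i] step2[of i] step4[of i] in simp_all)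
      show ?thesis
      proof
        assume "gap S (i + 4) = 1"
        then have "change u (e (i + 4) + 1)" using ch[of "i + 5"] step5[of i] by simp
        with no1 show False by blast
      qed
    qed
  qed
  then obtain N where "\<forall>i\<ge>N. gap S (i + 6) = gap S i" by blast
  then show ?thesis
    by (intro eventually_periodic_gaps[of _ N 6]) (use inf in \<open>simp_all add: S_def\<close>)
qed

text \<open>This ensures that a window of length \<open>K\<close> starting at or after
  \<open>N\<close> contains at most two changes.\<close>

definition sparse_changes :: "nat \<Rightarrow> nat \<Rightarrow> (nat \<Rightarrow> bool) \<Rightarrow> bool" where
  "sparse_changes K N v \<longleftrightarrow> (\<forall>a b c. a \<in> change_set v \<longrightarrow> b \<in> change_set v \<longrightarrow> c \<in> change_set v \<longrightarrow>
     N \<le> a \<longrightarrow> a < b \<longrightarrow> b < c \<longrightarrow> K \<le> c - a)"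

text \<open>Of two neighbouring gaps at least one is not 1 and hence at least \<open>K\<close>, and
  three changes span at least two gaps.\<close>

lemma sparse_changes_gaps:
  assumes inf: "infinite (change_set v)"
    and g: "\<forall>i\<ge>N. (gap (change_set v) i = 1 \<longrightarrow> gap (change_set v) (i + 1) \<noteq> 1) \<and>
      (gap (change_set v) i = 1 \<or> K \<le> gap (change_set v) i)"
  shows "sparse_changes K (enumerate (change_set v) N) v"
  unfolding sparse_changes_def
proof (intro allI impI)
  let ?p = "enumerate (change_set v)"
  fix a b c assume "a \<in> change_set v" "b \<in> change_set v" "c \<in> change_set v"
    and le: "?p N \<le> a" "a < b" "b < c"
  then obtain i j k where ijk: "a = ?p i" "b = ?p j" "c = ?p k"
    using enumerate_Ex[OF inf] by metis
  have "N \<le> i" "i < j" "j < k"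
    using le unfolding ijk enumerate_mono_iff[OF inf] enumerate_mono_le_iff[OF inf] by simp_all
  then have "?p (Suc (Suc i)) \<le> ?p k" by (simp add: enumerate_mono_le_iff[OF inf])
  then have "a + gap (change_set v) i + gap (change_set v) (i + 1) \<le> c"
    using enumerate_add_gap(1)[OF inf, of i] enumerate_add_gap(1)[OF inf, of "Suc i"] ijk by simp
  moreover have "K \<le> gap (change_set v) i \<or> K \<le> gap (change_set v) (i + 1)"
    using g \<open>N \<le> i\<close> by (metis le_add1 le_trans)
  ultimately show "K \<le> c - a" by linarith
qed

lemma admissible_past:
  assumes u: "admissible u"
  shows "eventually_periodic (\<lambda>n. u (- int n)) \<or> (\<forall>K. \<exists>N. sparse_changes K N (\<lambda>n. u (- int n)))"
proof (cases "finite (change_set (\<lambda>n. u (- int n)))")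
  case True
  then show ?thesis using eventually_periodic_finite_changes by blast
next
  case inf: False
  define S where "S = change_set (\<lambda>n. u (- int n))"
  have inf: "infinite S" using inf by (simp add: S_def)
  \<comment> \<open>A change at index \<open>n\<close> of the reversed half lies between the
    positions \<open>- n - 1\<close> and \<open>- n\<close>. Since \<open>e i\<close> moves left as
    \<open>i\<close> grows, the run lemmas apply with reversed indices.\<close>
  define e where "e i = - int (enumerate S i) - 1" for i
  have S: "n \<in> S \<longleftrightarrow> change u (- int n - 1)" for n
  proof -
    have eq: "- int (Suc n) = - int n - 1" "- int n - 1 + 1 = - int n" by simp_all
    show ?thesis unfolding S_def change_set_def change_def mem_Collect_eq eq by blast
  qed
  have step: "e i = e (i + 1) + int (gap S i)" for i
    using enumerate_add_gap(1)[OF inf, of i] by (simp add: e_def)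
  have ch: "change u (e i)" for i
    using enumerate_in_set[OF inf, of i] by (simp add: S e_def)
  have no: "\<not> change u n" if "e (i + 1) < n" "n < e i" for i n
  proof -
    have "enumerate S i < nat (- n - 1)" "nat (- n - 1) < enumerate S (Suc i)" and n: "- int (nat (- n - 1)) - 1 = n"
      using that by (simp_all add: e_def)
    then have "nat (- n - 1) \<notin> S" by (intro enumerate_between[OF inf])
    then show ?thesis unfolding S n .
  qed
  have con: "consecutive_changes u (e (i + 1)) (e i)" for i
  proof -
    have "e (i + 1) < e i" using step[of i] enumerate_add_gap(2)[OF inf, of i] by simp
    then show ?thesis unfolding consecutive_changes_def using ch no by blast
  qed
  have con2: "consecutive_changes u (e (i + 2)) (e (i + 1))"
    and con3: "consecutive_changes u (e (i + 3)) (e (i + 2))"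
    and con4: "consecutive_changes u (e (i + 4)) (e (i + 3))"
    and con5: "consecutive_changes u (e (i + 5)) (e (i + 4))" for i
    using con[of "i + 1"] con[of "i + 2"] con[of "i + 3"] con[of "i + 4"] by (simp_all add: numeral_eq_Suc)
  have step2: "e (i + 1) = e (i + 2) + int (gap S (i + 1))"
    and step3: "e (i + 2) = e (i + 3) + int (gap S (i + 2))"
    and step4: "e (i + 3) = e (i + 4) + int (gap S (i + 3))"
    and step5: "e (i + 4) = e (i + 5) + int (gap S (i + 4))" for i
    using step[of "i + 1"] step[of "i + 2"] step[of "i + 3"] step[of "i + 4"]
    by (simp_all add: numeral_eq_Suc)
  have "(\<exists>N. \<forall>i\<ge>N. gap S (i + 6) = gap S i) \<or>
    (\<forall>K. \<exists>N. \<forall>i\<ge>N. (gap S i = 1 \<longrightarrow> gap S (i + 1) \<noteq> 1) \<and> (gap S i = 1 \<or> K \<le> gap S i))"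
  proof (rule backward_gaps)
    fix i
    show "1 \<le> gap S i" by (rule enumerate_add_gap(2)[OF inf])
    show "gap S i \<le> gap S (i + 1)" if "2 \<le> gap S (i + 1)"
      using long_run_long_run[OF u con2 con, of i] that step[of i] step2[of i] by simp
    show "gap S i \<le> gap S (i + 2)" if "2 \<le> gap S (i + 2)" "gap S (i + 1) = 1"
    proof -
      have e: "e (i + 1) = e (i + 2) + 1" using step2[of i] that by simp
      show ?thesis
        using long_run_single_long_run[OF u con3 con2[of i, unfolded e] con[of i, unfolded e]]
          that step[of i] step3[of i] e by simp
    qed
    show "gap S i = 1" if "gap S (i + 2) = 1" "gap S (i + 1) = 1"
    proof (rule ccontr)
      let ?a = "e (i + 3)"
      assume "gap S i \<noteq> 1"
      then have "2 \<le> gap S i" using enumerate_add_gap(2)[OF inf, of i] by linarith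
      then have "\<not> change u (?a + 3)"
        using no[of i "?a + 3"] step[of i] step2[of i] step3[of i] that by simp
      moreover have "e (i + 2) = ?a + 1" "e (i + 1) = ?a + 2" using step3[of i] step2[of i] that by simp_all
      then have "change u (?a + 1)" "change u (?a + 2)" using ch by metis+
      ultimately show False using two_singles[OF u ch] by blast
    qed
    show "gap S i \<noteq> 1" if "2 \<le> gap S (i + 3)" "2 \<le> gap S (i + 2)" "gap S (i + 1) = gap S (i + 2)"
    proof
      assume "gap S i = 1"
      then have "change u (e (i + 1) + 1)" using ch[of i] step[of i] by simp
      moreover have "\<not> change u (e (i + 1) + 1)"
        by (rule equal_long_runs_no_single[OF u con4 con3 con2])
          (use that step2[of i] step3[of i] step4[of i] in simp_all)
      ultimately show False by blast
    qed
    show "gap S i \<noteq> 1" if "2 \<le> gap S (i + 4)" "2 \<le> gap S (i + 3)" "gap S (i + 2) = 1"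
      "gap S (i + 1) = gap S (i + 3)"
    proof -
      have e: "e (i + 2) = e (i + 3) + 1" using step3[of i] that by simp
      have no1: "\<not> change u (e (i + 1) + 1)"
        by (rule equal_long_runs_around_single_no_single
            [OF u con5 con4 con3[of i, unfolded e] con2[of i, unfolded e]])
          (use that e step2[of i] step4[of i] step5[of i] in simp_all)
      show ?thesis
      proof
        assume "gap S i = 1"
        then have "change u (e (i + 1) + 1)" using ch[of i] step[of i] by simp
        with no1 show False by blast
      qed
    qed
  qed
  then show ?thesis
  proof
    assume "\<exists>N. \<forall>i\<ge>N. gap S (i + 6) = gap S i"
    then obtain N where "\<forall>i\<ge>N. gap S (i + 6) = gap S i" by blast
    then have "eventually_periodic (\<lambda>n. u (- int n))"
      by (intro eventually_periodic_gaps[of _ N 6]) (use inf in \<open>simp_all add: S_def\<close>)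
    then show ?thesis by blast
  next
    assume "\<forall>K. \<exists>N. \<forall>i\<ge>N. (gap S i = 1 \<longrightarrow> gap S (i + 1) \<noteq> 1) \<and> (gap S i = 1 \<or> K \<le> gap S i)"
    then show ?thesis
      using sparse_changes_gaps[OF inf[unfolded S_def]] unfolding S_def by blast
  qed
qed

text \<open>Finite data determine such a sequence: a threshold \<open>N\<close>, a period
  \<open>P\<close> and the first \<open>N + P\<close> digits.\<close>

lemma countable_eventually_periodic: "countable {v. eventually_periodic v}"
proof (rule countable_subset)
  let ?f = "\<lambda>(N, P, l). \<lambda>n. if n < N then l ! n else l ! (N + (n - N) mod P)"
  show "countable (range ?f :: (nat \<Rightarrow> bool) set)" by simp
  show "{v. eventually_periodic v} \<subseteq> range ?f"
  proof
    fix v :: "nat \<Rightarrow> bool" assume "v \<in> {v. eventually_periodic v}"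
    then obtain N P where P: "0 < P" and per: "\<And>n. n \<ge> N \<Longrightarrow> v (n + P) = v n"
      unfolding eventually_periodic_def by blast
    have mult: "v (N + t + P * k) = v (N + t)" for k t
    proof (induction k)
      case (Suc k)
      then show ?case using per[of "N + t + P * k"] by (simp add: algebra_simps)
    qed simp
    have "v n = ?f (N, P, map v [0..<N + P]) n" for n
    proof (cases "n < N")
      case False
      have "(n - N) mod P < P" using P by simp
      then have "?f (N, P, map v [0..<N + P]) n = v (N + (n - N) mod P)"
        using False by simp
      also have "\<dots> = v n"
        using mult[of "(n - N) mod P" "(n - N) div P", symmetric] False by (simp add: add.assoc)
      finally show ?thesis by (rule sym)
    qed simp
    then have "v = ?f (N, P, map v [0..<N + P])" by blast
    then show "v \<in> range ?f" by blast
  qed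
qed

section \<open>Sequences with sparse changes\<close>

lemma sparse_changes_window:
  assumes sp: "sparse_changes K N v" and n: "N \<le> n"
  shows "\<exists>c a b. a \<le> K \<and> b \<le> K \<and> (\<forall>i<K. v (n + i) = (if a \<le> i \<and> i < b then \<not> c else c))"
proof -
  \<comment> \<open>The first digit that leaves the value \<open>c\<close> is preceded by a change.
    This is applied from 0, then \<open>a\<close>, then \<open>b\<close>; the third change
    contradicts sparsity.\<close>
  have first_change: "\<exists>m. i \<le> m \<and> m < K \<and> n + m - 1 \<in> change_set v \<and> v (n + m) = (\<not> c) \<and> i < m \<and>
      (\<forall>j. i \<le> j \<longrightarrow> j < m \<longrightarrow> v (n + j) = c)"
    if "v (n + i) = c" "\<exists>m\<ge>i. m < K \<and> v (n + m) \<noteq> c" for i c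
  proof -
    define m where "m = (LEAST m. i \<le> m \<and> m < K \<and> v (n + m) \<noteq> c)"
    have m: "i \<le> m" "m < K" "v (n + m) \<noteq> c"
      using LeastI_ex[OF that(2)] by (simp_all add: m_def)
    have lt: "v (n + j) = c" if "i \<le> j" "j < m" for j
      using not_less_Least[of j "\<lambda>m. i \<le> m \<and> m < K \<and> v (n + m) \<noteq> c"] that m(2) by (auto simp: m_def)
    have "i \<noteq> m" using m(3) that(1) by blast
    then have im: "i < m" using m(1) by simp
    then have "v (n + (m - 1)) = c" "Suc (n + m - 1) = n + m" "n + (m - 1) = n + m - 1" using lt[of "m - 1"] by auto
    then have "n + m - 1 \<in> change_set v" using m(3) by (simp add: change_set_def)
    with m im lt show ?thesis by blast
  qed
  show ?thesis
  proof (cases "\<exists>m\<ge>0. m < K \<and> v (n + m) \<noteq> v n")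
    case False
    \<comment> \<open>A constant window is described by a block starting at \<open>K\<close>, which
      is empty inside the window.\<close>
    then show ?thesis by (intro exI[of _ "v n"] exI[of _ K]) auto
  next
    case True
    then obtain a where a: "a < K" "n + a - 1 \<in> change_set v" "v (n + a) = (\<not> v n)" "0 < a"
      "\<And>j. j < a \<Longrightarrow> v (n + j) = v n"
      using first_change[of 0 "v n"] by auto
    show ?thesis
    proof (cases "\<exists>m\<ge>a. m < K \<and> v (n + m) \<noteq> (\<not> v n)")
      case False
      then show ?thesis
        using a by (intro exI[of _ "v n"] exI[of _ a] exI[of _ K]) auto
    next
      case True
      then obtain b where b: "b < K" "n + b - 1 \<in> change_set v" "v (n + b) = v n" "a < b"
        "\<And>j. a \<le> j \<Longrightarrow> j < b \<Longrightarrow> v (n + j) = (\<not> v n)"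
        using first_change[of a "\<not> v n"] a(3) by auto
      have nob: "\<not> (\<exists>m\<ge>b. m < K \<and> v (n + m) \<noteq> v n)"
      proof
        assume "\<exists>m\<ge>b. m < K \<and> v (n + m) \<noteq> v n"
        then obtain c where c: "c < K" "n + c - 1 \<in> change_set v" "b < c"
          using first_change[of b "v n"] b(3) by auto
        then have "K \<le> (n + c - 1) - (n + a - 1)"
          using sp[unfolded sparse_changes_def, rule_format, OF a(2) b(2) c(2)] n a(4) b(4) c(3)
          by simp
        with c(1) a(4) show False by linarith
      qed
      have "v (n + i) = (if a \<le> i \<and> i < b then \<not> v n else v n)" if "i < K" for i
      proof (cases "i < a")
        case True
        with a(5) show ?thesis by simp
      next
        case False
        then show ?thesis using b(5)[of i] nob that by (cases "i < b") auto
      qed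
      moreover have "a \<le> K" "b \<le> K" using a(1) b(1) by simp_all
      ultimately show ?thesis by blast
    qed
  qed
qed

section \<open>Counting covers for sequences with few windows\<close>

text \<open>Words of length \<open>K\<close> are represented by infinite sequences of which only the
  first \<open>K\<close> digits count.\<close>

definition window_seqs :: "nat \<Rightarrow> (nat \<Rightarrow> bool) set \<Rightarrow> nat \<Rightarrow> (nat \<Rightarrow> bool) set" where
  "window_seqs K Q N = {v. \<forall>n\<ge>N. \<exists>q\<in>Q. \<forall>i<K. v (n + i) = q i}"

lemma window_seqs_shift:
  assumes v: "v \<in> window_seqs K Q N" and N: "N \<le> L + M"
  shows "(\<lambda>i. v (i + M)) \<in> window_seqs K Q L"
  unfolding window_seqs_def
proof (intro CollectI allI impI)
  fix n assume "L \<le> n"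
  with N have "N \<le> n + M" by simp
  with v obtain q where q: "q \<in> Q" "\<forall>i<K. v (n + M + i) = q i"
    unfolding window_seqs_def by blast
  have "n + i + M = n + M + i" for i by simp
  with q show "\<exists>q\<in>Q. \<forall>i<K. v (n + i + M) = q i" by metis
qed

text \<open>There are at most \<open>card Q ^ m\<close> ways to fill the first \<open>m\<close>
  blocks of length \<open>K\<close>; \<open>C\<close> collects left endpoints of the corresponding
  intervals. The induction prepends one word to a tail that is already covered.\<close>

lemma window_seqs_cover_0:
  assumes Q: "finite Q"
  shows "\<exists>C. finite C \<and> card C \<le> card Q ^ m \<and>
    (\<forall>v\<in>window_seqs K Q 0. \<exists>c\<in>C. c \<le> binval v \<and> binval v \<le> c + (1 / 2 ^ K) ^ m)"
proof (induction m)
  case 0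
  show ?case by (rule exI[of _ "{0}"]) (simp add: binval_nonneg binval_le_1)
next
  case (Suc m)
  then obtain C where C: "finite C" "card C \<le> card Q ^ m"
    "\<forall>v\<in>window_seqs K Q 0. \<exists>c\<in>C. c \<le> binval v \<and> binval v \<le> c + (1 / 2 ^ K) ^ m" by blast
  define f where "f = (\<lambda>(q :: nat \<Rightarrow> bool, c). (\<Sum>i<K. of_bool (q i) / 2 ^ (i + 1)) + c / 2 ^ K :: real)"
  have "card (f ` (Q \<times> C)) \<le> card Q * card C"
    using card_image_le[of "Q \<times> C" f] Q C(1) by (simp add: card_cartesian_product)
  also have "\<dots> \<le> card Q ^ Suc m" using C(2) by simp
  finally have "card (f ` (Q \<times> C)) \<le> card Q ^ Suc m" .
  moreover have "\<exists>c\<in>f ` (Q \<times> C). c \<le> binval v \<and> binval v \<le> c + (1 / 2 ^ K) ^ Suc m"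
    if v: "v \<in> window_seqs K Q 0" for v
  proof -
    have "(\<lambda>i. v (i + K)) \<in> window_seqs K Q 0"
      by (rule window_seqs_shift[OF v]) simp
    then obtain c where c: "c \<in> C" "c \<le> binval (\<lambda>i. v (i + K))"
      "binval (\<lambda>i. v (i + K)) \<le> c + (1 / 2 ^ K) ^ m" using C(3) by blast
    have "\<exists>q\<in>Q. \<forall>i<K. v (0 + i) = q i" using v unfolding window_seqs_def by blast
    then obtain q where q: "q \<in> Q" "\<forall>i<K. v i = q i" unfolding add_0 by blast
    have "(\<Sum>i<K. of_bool (v i) / 2 ^ (i + 1) :: real) = (\<Sum>i<K. of_bool (q i) / 2 ^ (i + 1))"
      using q(2) by (intro sum.cong) auto
    then have eq: "binval v = f (q, c) + (binval (\<lambda>i. v (i + K)) - c) / 2 ^ K"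
      using binval_split[of v K] by (simp add: f_def diff_divide_distrib)
    have lower: "0 \<le> (binval (\<lambda>i. v (i + K)) - c) / 2 ^ K" using c(2) by (intro divide_nonneg_nonneg) simp_all
    have upper: "(binval (\<lambda>i. v (i + K)) - c) / 2 ^ K \<le> (1 / 2 ^ K) ^ m / 2 ^ K"
      using c by (intro divide_right_mono) auto
    have "(1 / 2 ^ K :: real) ^ m / 2 ^ K = (1 / 2 ^ K) ^ Suc m" by simp
    with eq lower upper have "f (q, c) \<le> binval v" "binval v \<le> f (q, c) + (1 / 2 ^ K) ^ Suc m"
      by linarith+
    moreover have "f (q, c) \<in> f ` (Q \<times> C)" using q(1) c(1) by blast
    ultimately show ?thesis by blast
  qed
  ultimately show ?case
    using Q C(1) by (intro exI[of _ "f ` (Q \<times> C)"]) auto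
qed

text \<open>The first \<open>N\<close> digits are arbitrary, encoded by the set \<open>A\<close> of
  positions carrying a 1. They cost a factor 2^N that does not grow with \<open>m\<close>.\<close>

lemma window_seqs_cover:
  assumes Q: "finite Q"
  shows "\<exists>C. finite C \<and> card C \<le> 2 ^ N * card Q ^ m \<and>
    (\<forall>v\<in>window_seqs K Q N. \<exists>c\<in>C. c \<le> binval v \<and> binval v \<le> c + (1 / 2 ^ K) ^ m)"
proof -
  obtain C where C: "finite C" "card C \<le> card Q ^ m"
    "\<forall>v\<in>window_seqs K Q 0. \<exists>c\<in>C. c \<le> binval v \<and> binval v \<le> c + (1 / 2 ^ K) ^ m"
    using window_seqs_cover_0[OF Q, of m K] by blast
  define f where "f = (\<lambda>(A, c). (\<Sum>i<N. of_bool (i \<in> A) / 2 ^ (i + 1)) + c / 2 ^ N :: real)"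
  have "card (f ` (Pow {..<N} \<times> C)) \<le> 2 ^ N * card C"
    using card_image_le[of "Pow {..<N} \<times> C" f] C(1) by (simp add: card_cartesian_product card_Pow)
  also have "\<dots> \<le> 2 ^ N * card Q ^ m" using C(2) by simp
  finally have "card (f ` (Pow {..<N} \<times> C)) \<le> 2 ^ N * card Q ^ m" .
  moreover have "\<exists>c\<in>f ` (Pow {..<N} \<times> C). c \<le> binval v \<and> binval v \<le> c + (1 / 2 ^ K) ^ m"
    if v: "v \<in> window_seqs K Q N" for v
  proof -
    have "(\<lambda>i. v (i + N)) \<in> window_seqs K Q 0"
      by (rule window_seqs_shift[OF v]) simp
    then obtain c where c: "c \<in> C" "c \<le> binval (\<lambda>i. v (i + N))"
      "binval (\<lambda>i. v (i + N)) \<le> c + (1 / 2 ^ K) ^ m" using C(3) by blast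
    define A where "A = {i. i < N \<and> v i}"
    have "(\<Sum>i<N. of_bool (v i) / 2 ^ (i + 1) :: real) = (\<Sum>i<N. of_bool (i \<in> A) / 2 ^ (i + 1))"
      by (intro sum.cong) (auto simp: A_def)
    then have eq: "binval v = f (A, c) + (binval (\<lambda>i. v (i + N)) - c) / 2 ^ N"
      using binval_split[of v N] by (simp add: f_def diff_divide_distrib)
    have lower: "0 \<le> (binval (\<lambda>i. v (i + N)) - c) / 2 ^ N" using c(2) by (intro divide_nonneg_nonneg) simp_all
    \<comment> \<open>The contraction by 2^N due to the prefix is simply discarded.\<close>
    have upper: "(binval (\<lambda>i. v (i + N)) - c) / 2 ^ N \<le> (1 / 2 ^ K) ^ m / 1"
      using c by (intro frac_le) auto
    from eq lower upper have "f (A, c) \<le> binval v" "binval v \<le> f (A, c) + (1 / 2 ^ K) ^ m"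
      by linarith+
    moreover have "f (A, c) \<in> f ` (Pow {..<N} \<times> C)" using c(1) by (auto simp: A_def)
    ultimately show ?thesis by blast
  qed
  ultimately show ?thesis
    using C(1) by (intro exI[of _ "f ` (Pow {..<N} \<times> C)"]) auto
qed

lemma power_powr:
  fixes x :: real
  assumes "0 < x"
  shows "(x ^ m) powr s = (x powr s) ^ m"
  using assms by (induction m) (simp_all add: powr_mult)

lemma vertical_segment_bounds:
  fixes x c r :: real
  assumes "0 \<le> r"
  shows "bounded ({x} \<times> {c..c + r})" "diameter ({x} \<times> {c..c + r}) \<le> r"
proof -
  show "bounded ({x} \<times> {c..c + r})" by (intro bounded_Times) auto
  show "diameter ({x} \<times> {c..c + r}) \<le> r"
    by (rule diameter_le) (use assms in \<open>auto simp: norm_Pair\<close>)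
qed

text \<open>At scale 2^(-K m) the cover by vertical segments costs at most 2^N \<rho>^m, where
  \<rho> is the quantity bounded in \<open>small\<close>. As \<rho> < 1, this tends to 0.\<close>

lemma window_seqs_null:
  fixes x :: real
  assumes Q: "finite Q" and K: "0 < K" and s: "0 < s" and small: "card Q * (1 / 2 ^ K) powr s < 1"
  shows "hausdorff_null s ({x} \<times> binval ` window_seqs K Q N)"
proof (rule hausdorff_null_finite_covers[OF s])
  fix \<delta> \<epsilon> :: real assume \<delta>: "\<delta> > 0" and \<epsilon>: "\<epsilon> > 0"
  let ?\<rho> = "card Q * (1 / 2 ^ K) powr s"
  have "1 / 2 ^ K < (1 :: real)" using K by simp
  then have "(\<lambda>m. (1 / 2 ^ K :: real) ^ m) \<longlonglongrightarrow> 0"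
    by (intro LIMSEQ_power_zero) simp
  then have "\<forall>\<^sub>F m in sequentially. (1 / 2 ^ K :: real) ^ m < \<delta>"
    using \<delta> by (rule order_tendstoD)
  moreover have "(\<lambda>m. 2 ^ N * ?\<rho> ^ m) \<longlonglongrightarrow> 2 ^ N * 0"
    using small by (intro tendsto_mult tendsto_const LIMSEQ_power_zero) simp
  then have "\<forall>\<^sub>F m in sequentially. 2 ^ N * ?\<rho> ^ m < \<epsilon>"
    using \<epsilon> by (intro order_tendstoD(2)[of _ "2 ^ N * 0"]) simp_all
  ultimately have "\<forall>\<^sub>F m in sequentially. (1 / 2 ^ K :: real) ^ m < \<delta> \<and> 2 ^ N * ?\<rho> ^ m < \<epsilon>"
    by (rule eventually_conj)
  from eventually_happens'[OF sequentially_bot this]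
  obtain m where m: "(1 / 2 ^ K :: real) ^ m < \<delta>" "2 ^ N * ?\<rho> ^ m < \<epsilon>"
    by blast
  define r where "r = (1 / 2 ^ K :: real) ^ m"
  have r: "0 < r" by (simp add: r_def)
  obtain C where C: "finite C" "card C \<le> 2 ^ N * card Q ^ m"
    "\<forall>v\<in>window_seqs K Q N. \<exists>c\<in>C. c \<le> binval v \<and> binval v \<le> c + r"
    using window_seqs_cover[OF Q, of N m K] unfolding r_def by blast
  define D where "D = (\<lambda>c. {x} \<times> {c..c + r}) ` C"
  have "card D \<le> card C" unfolding D_def using C(1) by (rule card_image_le)
  then have "real (card D) \<le> real (2 ^ N * card Q ^ m)"
    using C(2) by (intro of_nat_mono) (rule le_trans)
  moreover have "r powr s = ((1 / 2 ^ K) powr s) ^ m"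
    unfolding r_def by (rule power_powr) simp
  ultimately have "card D * r powr s \<le> (2 ^ N * card Q ^ m) * ((1 / 2 ^ K) powr s) ^ m"
    by (intro mult_mono) auto
  also have "\<dots> = 2 ^ N * ?\<rho> ^ m" by (simp add: power_mult_distrib)
  finally have small: "card D * r powr s \<le> \<epsilon>" using m(2) by simp
  have cover: "{x} \<times> binval ` window_seqs K Q N \<subseteq> \<Union> D"
  proof
    fix z assume "z \<in> {x} \<times> binval ` window_seqs K Q N"
    then obtain v where v: "v \<in> window_seqs K Q N" "z = (x, binval v)" by blast
    then obtain c where "c \<in> C" "c \<le> binval v" "binval v \<le> c + r"
      using bspec[OF C(3) v(1)] by blast
    with v(2) have "{x} \<times> {c..c + r} \<in> D" "z \<in> {x} \<times> {c..c + r}" by (simp_all add: D_def)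
    then show "z \<in> \<Union> D" by blast
  qed
  have diam: "\<forall>V\<in>D. bounded V \<and> diameter V \<le> r"
    using vertical_segment_bounds[OF less_imp_le[OF r], of x] unfolding D_def by blast
  have "finite D" "0 \<le> r" "r \<le> \<delta>" using C(1) r m(1) by (simp_all add: D_def r_def)
  with cover diam small show "\<exists>C r. finite C \<and> {x} \<times> binval ` window_seqs K Q N \<subseteq> \<Union> C \<and> 0 \<le> r \<and> r \<le> \<delta> \<and>
      (\<forall>V\<in>C. bounded V \<and> diameter V \<le> r) \<and> card C * r powr s \<le> \<epsilon>"
    by (intro exI[of _ D] exI[of _ r] conjI)
qed

text \<open>A window with at most two changes is constant except on one block, so a digit and two
  endpoints describe it; degenerate blocks account for fewer changes.\<close>

definition two_change_words :: "nat \<Rightarrow> (nat \<Rightarrow> bool) set" where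
  "two_change_words K = (\<lambda>(c, a, b) i. if a \<le> i \<and> i < b then \<not> c else c) ` (UNIV \<times> {..K} \<times> {..K})"

lemma two_change_words_card:
  "finite (two_change_words K)" "card (two_change_words K) \<le> 2 * (K + 1)\<^sup>2"
proof -
  show "finite (two_change_words K)" unfolding two_change_words_def by (intro finite_imageI) simp
  have "card (two_change_words K) \<le> card ((UNIV :: bool set) \<times> {..K} \<times> {..K})"
    unfolding two_change_words_def by (rule card_image_le) simp
  then show "card (two_change_words K) \<le> 2 * (K + 1)\<^sup>2"
    by (simp add: card_cartesian_product power2_eq_square)
qed

lemma sparse_changes_window_seqs:
  assumes "sparse_changes K N v"
  shows "v \<in> window_seqs K (two_change_words K) N"
  unfolding window_seqs_def
proof (intro CollectI allI impI)
  fix n assume "N \<le> n"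
  then obtain c a b where ab: "a \<le> K" "b \<le> K"
    and w: "\<forall>i<K. v (n + i) = (if a \<le> i \<and> i < b then \<not> c else c)"
    using sparse_changes_window[OF assms] by blast
  have mem: "(\<lambda>i. if a \<le> i \<and> i < b then \<not> c else c) \<in> two_change_words K"
    unfolding two_change_words_def by (intro image_eqI[of _ _ "(c, a, b)"]) (use ab in simp_all)
  show "\<exists>q\<in>two_change_words K. \<forall>i<K. v (n + i) = q i"
    by (rule bexI[OF _ mem]) (rule w)
qed

lemma square_less_exponential:
  assumes s: "0 < s"
  shows "\<exists>K::nat. 0 < K \<and> real (2 * (K + 1)\<^sup>2) * (1 / 2 ^ K) powr s < 1"
proof -
  \<comment> \<open>With this \<open>r\<close> the claim reads 2 ((K + 1) r^K)^2 < 1, so it suffices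
    to beat a linear factor.\<close>
  define r where "r = (1 / 2 :: real) powr (s / 2)"
  have "s / 2 * ln (1 / 2 :: real) < 0" using s by (intro mult_pos_neg) simp_all
  then have "exp (s / 2 * ln (1 / 2 :: real)) < 1" by (simp only: exp_less_one_iff)
  then have r: "0 < r" "r < 1" unfolding r_def powr_def by simp_all
  have "(\<lambda>n. real n * r ^ n) \<longlonglongrightarrow> 0"
    using r by (intro powser_times_n_limit_0) simp
  \<comment> \<open>The bound \<open>r / 2\<close> rather than 1/2 pays for the factor
    \<open>r\<close> lost in passing from exponent \<open>Suc K\<close> to \<open>K\<close>.\<close>
  then have "\<forall>\<^sub>F n in sequentially. real n * r ^ n < r / 2"
    using r by (intro order_tendstoD) auto
  then obtain M where M: "\<And>n. n \<ge> M \<Longrightarrow> real n * r ^ n < r / 2"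
    unfolding eventually_sequentially by blast
  define K where "K = Suc M"
  have "real (Suc K) * r ^ Suc K < r / 2" by (rule M) (simp add: K_def)
  also have "real (Suc K) * r ^ Suc K = r * ((real K + 1) * r ^ K)" by simp
  finally have "r * ((real K + 1) * r ^ K) < r * (1 / 2)" by simp
  then have "(real K + 1) * r ^ K < 1 / 2" using r(1) by simp
  then have "((real K + 1) * r ^ K)\<^sup>2 < (1 / 2)\<^sup>2" 
    by (rule power_strict_mono) (use r(1) in simp_all)
  moreover have "(r ^ K)\<^sup>2 = (1 / 2 ^ K) powr s"
  proof -
    have "(r ^ K)\<^sup>2 = (r\<^sup>2) ^ K" by (simp add: power_mult[symmetric] mult.commute)
    also have "r\<^sup>2 = (1 / 2) powr s" unfolding r_def power2_eq_square powr_add[symmetric] by simp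
    also have "((1 / 2 :: real) powr s) ^ K = ((1 / 2) ^ K) powr s"
      by (rule power_powr[symmetric]) simp
    finally show ?thesis by (simp add: power_divide)
  qed
  ultimately have "(real K + 1)\<^sup>2 * (1 / 2 ^ K) powr s < (1 / 2)\<^sup>2"
    by (simp only: power_mult_distrib)
  also have "(1 / 2)\<^sup>2 < (1 / 2 :: real)" by (simp add: power2_eq_square)
  finally have "real (2 * (K + 1)\<^sup>2) * (1 / 2 ^ K) powr s < 1"
    by (simp add: ac_simps)
  moreover have "0 < K" by (simp add: K_def)
  ultimately show ?thesis by blast
qed

section \<open>The parallelogram\<close>

lemma parallelogram_subset_P1:
  assumes "0 < 2 * x - y" "2 * x - y < 1" "2 < 4 * x + y" "4 * x + y < 3"
  shows "(x, y) \<in> P1"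
proof -
  let ?H = "convex hull {(1/3, 2/3), (1/2, 1), (2/3, 1/3), (1/2, 0)} :: (real \<times> real) set"
  define T :: "(real \<times> real) set"
    where "T = {z. 0 < 2 * fst z - snd z} \<inter> {z. 2 * fst z - snd z < 1} \<inter>
      {z. 2 < 4 * fst z + snd z} \<inter> {z. 4 * fst z + snd z < 3}"
  have "open T"
    unfolding T_def by (intro open_Int open_Collect_less continuous_intros)
  moreover have "T \<subseteq> ?H"
  proof
    fix z assume z: "z \<in> T"
    obtain p q where pq: "z = (p, q)" by (cases z)
    \<comment> \<open>\<open>a\<close> and \<open>b\<close> are affine coordinates with values in
      (0, 1): interpolation with \<open>a\<close> along two opposite sides, then with
      \<open>b\<close> between the results, reaches \<open>z\<close>.\<close>
    define a where "a = 2 * p - q"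
    define b where "b = 4 * p + q - 2"
    have ab: "0 < a" "a < 1" "0 < b" "b < 1"
      using z by (simp_all add: T_def pq a_def b_def)
    have hull: "v \<in> ?H" if "v \<in> {(1/3, 2/3), (1/2, 1), (2/3, 1/3), (1/2, 0)}" for v
      using that by (rule hull_inc)
    have conv: "(1 - t) *\<^sub>R v + t *\<^sub>R w \<in> ?H" if "v \<in> ?H" "w \<in> ?H" "0 < t" "t < 1" for t v w
      by (rule convexD[OF convex_convex_hull]) (use that in simp_all)
    have "(1 - a) *\<^sub>R (1/3, 2/3) + a *\<^sub>R (1/2, 0) \<in> ?H" (is "?u \<in> _")
      by (intro conv hull ab) simp_all
    moreover have "(1 - a) *\<^sub>R (1/2, 1) + a *\<^sub>R (2/3, 1/3) \<in> ?H" (is "?v \<in> _")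
      by (intro conv hull ab) simp_all
    ultimately have "(1 - b) *\<^sub>R ?u + b *\<^sub>R ?v \<in> ?H"
      by (rule conv[OF _ _ ab(3,4)])
    moreover have "(1 - b) *\<^sub>R ?u + b *\<^sub>R ?v = z"
      unfolding pq by (simp add: a_def b_def prod_eq_iff) (simp add: field_simps)
    ultimately show "z \<in> ?H" by simp
  qed
  ultimately have "T \<subseteq> P1" unfolding P1_def by (rule interior_maximal[rotated])
  with assms show ?thesis by (auto simp: T_def)
qed

lemma openin_P1: "openin (top_of_set unit_square) P1"
proof -
  have "P1 \<subseteq> convex hull {(1/3, 2/3), (1/2, 1), (2/3, 1/3), (1/2, 0)}"
    unfolding P1_def by (rule interior_subset)
  also have "\<dots> \<subseteq> unit_square"
    unfolding unit_square_def by (intro hull_minimal convex_Times) auto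
  finally have "P1 = unit_square \<inter> P1" by blast
  moreover have "open P1" by (simp add: P1_def)
  ultimately show ?thesis unfolding openin_open by blast
qed

section \<open>From surviving points to admissible sequences\<close>

lemma coding_binval:
  assumes "u \<in> binary_seqs"
  shows "coding (shift m u) = (binval (\<lambda>i. u (m + 1 + int i) = 1), binval (\<lambda>i. u (m - int i) = 1))"
proof -
  have "real (u k) = of_bool (u k = 1)" for k
    using assms unfolding binary_seqs_def by (auto simp: Pi_iff)
  then show ?thesis by (simp add: coding_def shift_def binval_def algebra_simps)
qed

text \<open>At 01 the point is ((1 + z)/4, y), which lies in the parallelogram whenever 1 - z < y <
  (1 + z)/2. The case 10 corresponds to it under (x, y) -> (1 - x, 1 - y).\<close>

lemma hole_avoidance:
  assumes ch: "change U n"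
    and out: "(binval (\<lambda>i. U (n + int i)), binval (\<lambda>i. U (n - 1 - int i))) \<notin> P1"
  shows "binval (past U n) \<le> 1 - binval (future U n) \<or> (1 + binval (future U n)) / 2 \<le> binval (past U n)"
proof -
  define y where "y = binval (\<lambda>i. U (n - 1 - int i))"
  define z where "z = binval (\<lambda>i. U (n + 2 + int i))"
  have x: "binval (\<lambda>i. U (n + int i)) = (of_bool (U n) + (of_bool (U (n + 1)) + z) / 2) / 2"
  proof -
    have "binval (\<lambda>i. U (n + int i)) = (of_bool (U n) + binval (\<lambda>i. U (n + 1 + int i))) / 2"
      by (subst binval_Suc) (simp add: add.assoc)
    also have "binval (\<lambda>i. U (n + 1 + int i)) = (of_bool (U (n + 1)) + z) / 2"
      unfolding z_def by (subst binval_Suc) (simp add: add.assoc)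
    finally show ?thesis .
  qed
  have bounds: "0 \<le> y" "y \<le> 1" "0 \<le> z" "z \<le> 1"
    unfolding y_def z_def by (rule binval_nonneg binval_le_1)+
  show ?thesis
  proof (cases "U n")
    case True
    then have "binval (past U n) = 1 - y" "binval (future U n) = 1 - z"
      unfolding past_def future_def y_def z_def by (simp_all flip: binval_not)
    moreover have "U (n + 1) = False" using ch True by (simp add: change_def)
    then have eq: "binval (\<lambda>i. U (n + int i)) = 1 / 2 + z / 4" using x True by simp
    have "(1 / 2 + z / 4, y) \<notin> P1" using out unfolding eq y_def .
    then have "\<not> (0 < 1 + z / 2 - y \<and> z / 2 < y \<and> 0 < z + y \<and> z + y < 1)"
      using parallelogram_subset_P1[of "1 / 2 + z / 4" y] by argo
    ultimately show ?thesis using bounds by argo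
  next
    case False
    then have "binval (past U n) = y" "binval (future U n) = z"
      unfolding past_def future_def y_def z_def by simp_all
    moreover have "U (n + 1) = True" using ch False by (simp add: change_def)
    then have eq: "binval (\<lambda>i. U (n + int i)) = 1 / 4 + z / 4" using x False by simp
    have "(1 / 4 + z / 4, y) \<notin> P1" using out unfolding eq y_def .
    then have "\<not> (0 < (1 + z) / 2 - y \<and> (1 + z) / 2 - y < 1 \<and> 1 < z + y \<and> z + y < 2)"
      using parallelogram_subset_P1[of "1 / 4 + z / 4" y] by argo
    \<comment> \<open>The second and fourth inequalities can fail only at y = 0, z = 1 and at y = z
      = 1, where the conclusion holds with equality.\<close>
    ultimately show ?thesis using bounds by argo
  qed
qed

text \<open>By \<open>binval_le_lex\<close> the first inequality compares \<open>y\<close> with the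
  complement of \<open>z\<close>, the second compares \<open>z\<close> preceded by 1 with
  \<open>y\<close>. The exceptional dyadic pairs have constant tails, which \<open>tails\<close>
  excludes.\<close>

lemma avoids_lex_of_binval:
  assumes av: "binval y \<le> 1 - binval z \<or> (1 + binval z) / 2 \<le> binval y"
    and tails: "\<not> (\<exists>N c c'. \<forall>i\<ge>N. y i = c \<and> z i = c')"
  shows "avoids_lex y z"
  using av
proof
  assume "binval y \<le> 1 - binval z"
  then have le: "binval y \<le> binval (\<lambda>i. \<not> z i)" by (simp add: binval_not)
  have "\<not> (y k \<and> z k)" if "\<forall>i<k. y i \<noteq> z i" for k
  proof
    assume "y k \<and> z k"
    then have "(\<forall>i>k. \<not> y i) \<and> (\<forall>i>k. \<not> z i)"
      using binval_le_lex[OF le, of k] that by blast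
    then have "\<forall>i\<ge>Suc k. y i = False \<and> z i = False" by auto
    with tails show False by blast
  qed
  then show ?thesis unfolding avoids_lex_def by blast
next
  assume le: "(1 + binval z) / 2 \<le> binval y"
  \<comment> \<open>Prepending 1 gives the value \<open>(1 + binval z) / 2\<close> and aligns index
    \<open>k\<close> of \<open>z\<close> with index \<open>Suc k\<close> of
    \<open>y\<close>.\<close>
  define z' where "z' = case_nat True z"
  have z': "z' 0" "z' (Suc i) = z i" for i by (simp_all add: z'_def)
  have le: "binval z' \<le> binval y" using le by (subst binval_Suc) (simp add: z')
  have lex: "False" if "\<And>i. i < k \<Longrightarrow> z' i = y i" "z' k" "\<not> y k" for k
  proof -
    have "(\<forall>i>k. \<not> z' i) \<and> (\<forall>i>k. y i)" using binval_le_lex[OF le that] .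
    then have "\<forall>i\<ge>Suc k. y i = True \<and> z i = False"
      by (metis Suc_le_lessD less_SucI z'(2))
    with tails show False by blast
  qed
  have "y 0" using lex[of 0] z'(1) by blast
  moreover have "\<not> (z k \<and> \<not> y (Suc k))" if "\<forall>i<k. y (Suc i) = z i" for k
  proof
    assume "z k \<and> \<not> y (Suc k)"
    moreover have "z' i = y i" if "i < Suc k" for i
      using that \<open>\<forall>i<k. y (Suc i) = z i\<close> \<open>y 0\<close> z' by (cases i) auto
    ultimately show False using lex[of "Suc k"] z'(2) by blast
  qed
  ultimately show ?thesis unfolding avoids_lex_def by blast
qed

lemma finite_changes_of_tails:
  assumes "\<forall>i\<ge>N. past U n i = c \<and> future U n i = c'"
  shows "finite (change_set (\<lambda>k. U (int k + 1)))" "finite (change_set (\<lambda>k. U (- int k)))"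
proof -
  \<comment> \<open>Past this distance from the origin, both halves of \<open>U\<close> lie inside
    the constant tails seen from \<open>n\<close>.\<close>
  define M where "M = N + nat \<bar>n\<bar> + 2"
  have M: "int M = int N + \<bar>n\<bar> + 2" by (simp add: M_def)
  have f: "(U m \<noteq> U n) = c'" if "m \<ge> int M" for m
  proof -
    define i where "i = nat (m - n - 2)"
    have i: "n + 2 + int i = m" "N \<le> i" using that M by (simp_all add: i_def)
    show ?thesis using assms[rule_format, OF i(2)] unfolding future_def i(1) by blast
  qed
  have p: "(U (- m) \<noteq> U n) = c" if "m \<ge> int M" for m
  proof -
    define i where "i = nat (n - 1 + m)"
    have i: "n - 1 - int i = - m" "N \<le> i" using that M by (simp_all add: i_def)
    show ?thesis using assms[rule_format, OF i(2)] unfolding past_def i(1) by blast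
  qed
  have "k < M" if "k \<in> change_set (\<lambda>k. U (int k + 1))" for k
    using that f[of "int k + 1"] f[of "int (Suc k) + 1"] unfolding change_set_def by force
  then show "finite (change_set (\<lambda>k. U (int k + 1)))"
    using finite_nat_set_iff_bounded by blast
  have "k < M" if "k \<in> change_set (\<lambda>k. U (- int k))" for k
    using that p[of "int k"] p[of "int (Suc k)"] unfolding change_set_def by force
  then show "finite (change_set (\<lambda>k. U (- int k)))"
    using finite_nat_set_iff_bounded by blast
qed

lemma survivor_structure:
  assumes u: "u \<in> binary_seqs" and surv: "\<forall>n. coding (shift n u) \<notin> P1"
  defines "U \<equiv> \<lambda>k. u k = 1"
  shows "eventually_periodic (\<lambda>n. U (int n + 1)) \<and>
    (eventually_periodic (\<lambda>n. U (- int n)) \<or> (\<forall>K. \<exists>N. sparse_changes K N (\<lambda>n. U (- int n))))"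
proof (cases "\<exists>n N c c'. \<forall>i\<ge>N. past U n i = c \<and> future U n i = c'")
  case True
  \<comment> \<open>Sequences with constant tails in both directions may violate the lexicographic
    condition, but their halves have finitely many changes.\<close>
  then show ?thesis
    using finite_changes_of_tails[of _ U] eventually_periodic_finite_changes by metis
next
  case False
  have "avoids_lex (past U n) (future U n)" if "change U n" for n
  proof (rule avoids_lex_of_binval)
    \<comment> \<open>The shift by \<open>n - 1\<close> makes the digits at \<open>n\<close> and
      \<open>n + 1\<close> the first two of the horizontal coordinate.\<close>
    have "coding (shift (n - 1) u) \<notin> P1" using surv by blast
    then have "(binval (\<lambda>i. U (n + int i)), binval (\<lambda>i. U (n - 1 - int i))) \<notin> P1"
      unfolding coding_binval[OF u] U_def by simp
    then show "binval (past U n) \<le> 1 - binval (future U n) \<or>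
        (1 + binval (future U n)) / 2 \<le> binval (past U n)"
      by (rule hole_avoidance[OF that])
    show "\<not> (\<exists>N c c'. \<forall>i\<ge>N. past U n i = c \<and> future U n i = c')" using False by blast
  qed
  then have "admissible U" by (simp add: admissible_def)
  then show ?thesis using admissible_future admissible_past by blast
qed

section \<open>Covering the survivor set\<close>

text \<open>\<open>K\<close> is arbitrary here, so that it can be chosen afterwards according to the
  exponent \<open>s\<close>.\<close>

lemma survivor_set_P1_subset:
  defines "X \<equiv> binval ` {v. eventually_periodic v}"
  shows "survivor_set P1 \<subseteq>
    X \<times> X \<union> (\<Union>x\<in>X. \<Union>N. {x} \<times> binval ` window_seqs K (two_change_words K) N)"
proof
  fix p assume "p \<in> survivor_set P1"
  then obtain u where u: "u \<in> binary_seqs" "\<forall>n. coding (shift n u) \<notin> P1" "p = coding u"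
    unfolding survivor_set_def by blast
  define a where "a = (\<lambda>n::nat. u (int n + 1) = 1)"
  define b where "b = (\<lambda>n::nat. u (- int n) = 1)"
  have p: "p = (binval a, binval b)"
    using coding_binval[OF u(1), of 0] u(3) by (simp add: shift_0 a_def b_def add.commute)
  have "eventually_periodic a" and b: "eventually_periodic b \<or> (\<forall>K. \<exists>N. sparse_changes K N b)"
    using survivor_structure[OF u(1,2)] unfolding a_def b_def by blast+
  then have a: "binval a \<in> X" by (simp add: X_def)
  from b show "p \<in> X \<times> X \<union> (\<Union>x\<in>X. \<Union>N. {x} \<times> binval ` window_seqs K (two_change_words K) N)"
  proof
    assume "eventually_periodic b"
    then have "binval b \<in> X" by (simp add: X_def)
    with a show ?thesis by (simp add: p)
  next
    assume "\<forall>K. \<exists>N. sparse_changes K N b"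
    then obtain N where "b \<in> window_seqs K (two_change_words K) N"
      using sparse_changes_window_seqs by blast
    then have "p \<in> {binval a} \<times> binval ` window_seqs K (two_change_words K) N" by (simp add: p)
    with a show ?thesis by blast
  qed
qed

lemma survivor_set_P1_null:
  assumes s: "0 < s"
  shows "hausdorff_null s (survivor_set P1)"
proof -
  define X where "X = binval ` {v. eventually_periodic v}"
  have X: "countable X" unfolding X_def by (intro countable_image countable_eventually_periodic)
  obtain K where K: "0 < K" "real (2 * (K + 1)\<^sup>2) * (1 / 2 ^ K) powr s < 1"
    using square_less_exponential[OF s] by blast
  let ?Q = "two_change_words K"
  \<comment> \<open>The Boolean index presents the union of the two pieces as a countable
    union.\<close>
  let ?B = "\<lambda>b. if b then X \<times> X else (\<Union>x\<in>X. \<Union>N. {x} \<times> binval ` window_seqs K ?Q N)"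
  have "real (card ?Q) \<le> real (2 * (K + 1)\<^sup>2)"
    using two_change_words_card(2)[of K] by (rule of_nat_mono)
  then have "card ?Q * (1 / 2 ^ K) powr s \<le> real (2 * (K + 1)\<^sup>2) * (1 / 2 ^ K) powr s"
    by (rule mult_right_mono) simp
  also have "\<dots> < 1" by (rule K(2))
  finally have "hausdorff_null s (\<Union>x\<in>X. \<Union>N. {x} \<times> binval ` window_seqs K ?Q N)"
    by (intro hausdorff_null_UN[OF X] hausdorff_null_UN_nat window_seqs_null two_change_words_card K(1) s)
  moreover have "hausdorff_null s (X \<times> X)"
    using X by (intro hausdorff_null_countable s countable_SIGMA)
  ultimately have "hausdorff_null s (\<Union>b\<in>UNIV. ?B b)"
    by (intro hausdorff_null_UN) auto
  moreover have "survivor_set P1 \<subseteq> (\<Union>b\<in>UNIV. ?B b)"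
    using survivor_set_P1_subset[of K] unfolding X_def by (auto simp: UNIV_bool)
  ultimately show ?thesis by (rule hausdorff_null_subset)
qed

theorem proposition4p3:
  shows "dimension_trap P1"
  unfolding dimension_trap_def using openin_P1 hausdorff_dim_eq_0[OF survivor_set_P1_null] by blast

end
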